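(* Let $K$ be a Galois number field (i.e. $K/\mathbb{Q}$ is a finite Galois extension) with $G := \mathrm{Gal}(K/\mathbb{Q})$ and ring of integers $\mathcal{O}_K$, and let $R$ be an overring of $\mathcal{O}_K$, i.e. a ring with $\mathcal{O}_K \subseteq R \subseteq K$. The following are equivalent: (1) The action $\sigma \cdot [I] = [\sigma(I)]$, for $\sigma \in G$ and $I$ a fractional ideal of $R$, is well-defined; that is, for every $\sigma \in G$ and every nonzero fractional ideal $I$ of $R$, the set $\sigma(I)$ is again a fractional ideal of $R$ (so that $I \mapsto \sigma(I)$ is a map on the group of fractional ideals of $R$ descending to the class group). (2) $R$ is Galois-invariant: $\sigma(R) = R$ for all $\sigma \in G$. (3) For all $\mathfrak{p} \in \mathrm{Spec}(\mathcal{O}_K)$ and all $\sigma \in G$, $\mathfrak{p}R = R$ if and only if $\sigma(\mathfrak{p})R = R$. (4) For any $\mathfrak{p}, \mathfrak{q} \in \mathrm{Spec}(\mathcal{O}_K)$ lying over the same rational prime $p$, $\mathfrak{p}R = R$ if and only if $\mathfrak{q}R = R$.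
   Context: Every overring of the Dedekind domain $\mathcal{O}_K$ inside $K$ is itself a Dedekind domain (allowing the field $K$). A fractional ideal of $R$ is a nonzero $R$-submodule $I \subseteq K$ such that $\alpha I \subseteq R$ for some nonzero $\alpha \in K$; $[I]$ denotes its class modulo principal fractional ideals. *)

theory Defs
  imports
    "HOL-Algebra.Algebraic_Closure_Type"
    "HOL-Algebra.Subrings"
    "HOL-Algebra.Module"
    "HOL-Computational_Algebra.Polynomial"
begin

text \<open>
  The field \<open>K\<close> is the whole type \<open>'k\<close>; a subring \<open>S\<close> of \<open>K\<close> is a set, and is turned into
  a \<open>HOL-Algebra\<close> ring by restricting the carrier of \<^const>\<open>ring_of_type_algebra\<close>.
\<close>

abbreviation subring_of :: "'k::field_char_0 set \<Rightarrow> 'k ring" where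
  "subring_of S \<equiv> ring_of_type_algebra \<lparr>carrier := S\<rparr>"

definition rat_scale :: "rat \<Rightarrow> 'k::field_char_0 \<Rightarrow> 'k" where
  "rat_scale q x = of_rat q * x"

definition gal :: "('k::field_char_0 \<Rightarrow> 'k) set" where
  "gal = {\<sigma> \<in> ring_iso ring_of_type_algebra ring_of_type_algebra. \<forall>q. \<sigma> (of_rat q) = of_rat q}"

text \<open>\<open>K/\<rat>\<close> is finite, and the fixed field of \<open>Aut(K/\<rat>)\<close> is \<open>\<rat>\<close>.\<close>

definition galois_number_field :: "'k::field_char_0 itself \<Rightarrow> bool" where
  "galois_number_field _ \<longleftrightarrow>
     (\<exists>B :: 'k set. finite_dimensional_vector_space rat_scale B) \<and>
     {x :: 'k. \<forall>\<sigma>\<in>gal. \<sigma> x = x} = \<rat>"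

definition ring_of_integers :: "'k::field_char_0 set" where
  "ring_of_integers = {x. algebraic_int x}"

definition overring :: "'k::field_char_0 set \<Rightarrow> bool" where
  "overring R \<longleftrightarrow> subring R ring_of_type_algebra \<and> ring_of_integers \<subseteq> R"

definition spec :: "'k::field_char_0 set \<Rightarrow> 'k set set" where
  "spec S = {P. primeideal P (subring_of S)}"

definition lies_over :: "'k::field_char_0 set \<Rightarrow> nat \<Rightarrow> bool" where
  "lies_over P p \<longleftrightarrow> {n :: int. of_int n \<in> P} = {n. int p dvd n}"

text \<open>The extension \<open>PR\<close> of an ideal \<open>P\<close> of a subring of \<open>R\<close>.\<close>

definition ext_ideal :: "'k::field_char_0 set \<Rightarrow> 'k set \<Rightarrow> 'k set" where
  "ext_ideal P R = genideal (subring_of R) P"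

definition field_module :: "('k, 'k::field_char_0) module" where
  "field_module = \<lparr>carrier = UNIV, monoid.mult = (*), one = 1, zero = 0, add = (+),
     module.smult = (*)\<rparr>"

definition fractional_ideal :: "'k::field_char_0 set \<Rightarrow> 'k set \<Rightarrow> bool" where
  "fractional_ideal R I \<longleftrightarrow>
     submodule I (subring_of R) field_module \<and> I \<noteq> {0} \<and>
     (\<exists>\<alpha>. \<alpha> \<noteq> 0 \<and> (\<lambda>x. \<alpha> * x) ` I \<subseteq> R)"

text \<open>
  The product of \<open>I\<close> with the principal fractional ideal \<open>\<alpha>R\<close> is \<open>\<alpha>I\<close>, so this is the coset
  of \<open>I\<close> modulo principal fractional ideals.
\<close>

definition ideal_class :: "'k::field_char_0 set \<Rightarrow> 'k set \<Rightarrow> 'k set set" where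
  "ideal_class R I =
     {J. fractional_ideal R J \<and> (\<exists>\<alpha>. \<alpha> \<noteq> 0 \<and> J = (\<lambda>x. \<alpha> * x) ` I)}"

text \<open>
  \<open>\<sigma> \<cdot> [I] = [\<sigma>(I)]\<close> makes sense: \<open>\<sigma>(I)\<close> has a class because it is a fractional ideal of the
  same ring \<open>R\<close>, and that class depends only on the class of \<open>I\<close>.
\<close>

definition class_action_well_defined :: "'k::field_char_0 set \<Rightarrow> bool" where
  "class_action_well_defined R \<longleftrightarrow>
     (\<forall>\<sigma>\<in>gal. \<forall>I. fractional_ideal R I \<longrightarrow> fractional_ideal R (\<sigma> ` I)) \<and>
     (\<forall>\<sigma>\<in>gal. \<forall>I J. fractional_ideal R I \<longrightarrow> fractional_ideal R J \<longrightarrow>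
        ideal_class R I = ideal_class R J \<longrightarrow>
        ideal_class R (\<sigma> ` I) = ideal_class R (\<sigma> ` J))"

end

theory Submission
  imports Defs "Jordan_Normal_Form.Char_Poly"
begin

text \<open>
  For \<open>x \<in> K\<close> let \<open>D\<^sub>x\<close> be the ideal of all \<open>d \<in> O\<^sub>K\<close> with \<open>d x \<in> O\<^sub>K\<close>. The only fact about \<open>O\<^sub>K\<close>
  that is needed beyond integrality is \<open>1 \<in> D\<^sub>x + x D\<^sub>x\<close>, which replaces unique factorization of
  ideals: it follows from a primitive integer polynomial with root \<open>x\<close>, each of whose coefficients
  has the form \<open>s - x s'\<close> with Horner quotients \<open>s, s' \<in> D\<^sub>x\<close>. Consequently \<open>x \<in> R\<close> if and only if
  \<open>D\<^sub>x R = R\<close>, that is, if and only if no prime of \<open>R\<close> contains \<open>D\<^sub>x\<close>. If \<open>x \<in> R\<close> but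
  \<open>\<sigma> x \<notin> R\<close>, some prime of \<open>R\<close> contains \<open>\<sigma> D\<^sub>x\<close>; it contracts to \<open>\<sigma> P\<close> for a prime \<open>P \<supseteq> D\<^sub>x\<close> of
  \<open>O\<^sub>K\<close>, and \<open>P R = R\<close> while \<open>\<sigma> P R \<noteq> R\<close>, so (3) implies (2). Conditions (3) and (4) are linked
  by norms and prime avoidance, and applying (1) to \<open>I = R\<close> gives (2).
\<close>

subsection \<open>Algebraic integers\<close>

text \<open>The determinant trick: the vector listing \<open>V\<close> is an eigenvector, with
  eigenvalue \<open>x\<close>, of the coefficient matrix over \<open>'b\<close>, so \<open>x\<close>
  is a root of its characteristic polynomial. Taking \<open>of_int\<close> for \<open>h\<close>
  gives integrality, \<open>of_rat\<close> gives algebraicity; \<open>v0\<close> makes the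
  eigenvector nonzero.\<close>

lemma root_of_monic_poly_if_finite_stable:
  fixes h :: "'b::comm_ring_1 \<Rightarrow> 'a::field"
  assumes "comm_ring_hom h" and "finite V" and "v0 \<in> V" "v0 \<noteq> 0"
    and stable: "\<And>v. v \<in> V \<Longrightarrow> \<exists>c. x * v = (\<Sum>w\<in>V. h (c w) * w)"
  shows "\<exists>p. monic p \<and> poly (map_poly h p) x = 0"
proof -
  interpret comm_ring_hom h by fact
  define n where "n = card V"
  obtain f where f: "bij_betw f {0..<n} V"
    using ex_bij_betw_nat_finite[OF \<open>finite V\<close>] unfolding n_def by blast
  obtain c where c: "\<And>v. v \<in> V \<Longrightarrow> x * v = (\<Sum>w\<in>V. h (c v w) * w)"
    using stable by metis
  define B where "B = mat n n (\<lambda>(i, j). c (f i) (f j))"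
  define u where "u = vec n f"
  have B: "B \<in> carrier_mat n n" by (simp add: B_def)
  have fV: "i < n \<Longrightarrow> f i \<in> V" for i
    using f by (auto simp: bij_betw_def)
  have "map_mat h B *\<^sub>v u = x \<cdot>\<^sub>v u"
  proof (rule eq_vecI)
    fix i assume "i < dim_vec (x \<cdot>\<^sub>v u)"
    then have i: "i < n" by (simp add: u_def)
    then have "vec_index (map_mat h B *\<^sub>v u) i = (\<Sum>j = 0..<n. h (c (f i) (f j)) * f j)"
      by (simp add: B_def u_def scalar_prod_def)
    also have "\<dots> = (\<Sum>w\<in>V. h (c (f i) w) * w)"
      by (rule sum.reindex_bij_betw[OF f])
    also have "\<dots> = vec_index (x \<cdot>\<^sub>v u) i"
      using c[OF fV[OF i]] i by (simp add: u_def)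
    finally show "vec_index (map_mat h B *\<^sub>v u) i = vec_index (x \<cdot>\<^sub>v u) i" .
  qed (simp add: B_def u_def)
  moreover have "u \<noteq> 0\<^sub>v n"
  proof -
    have "v0 \<in> f ` {0..<n}"
      using f \<open>v0 \<in> V\<close> by (simp add: bij_betw_def)
    then obtain i where "i < n" "f i = v0" by auto
    then have "vec_index u i \<noteq> vec_index (0\<^sub>v n) i" using \<open>v0 \<noteq> 0\<close> by (simp add: u_def)
    then show ?thesis by metis
  qed
  ultimately have "eigenvalue (map_mat h B) x"
    unfolding eigenvalue_def eigenvector_def using B
    by (intro exI[of _ u]) (auto simp: u_def)
  then have "poly (char_poly (map_mat h B)) x = 0"
    using B by (subst (asm) eigenvalue_root_char_poly[of _ n]) auto
  then have "poly (map_poly h (char_poly B)) x = 0"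
    by (simp add: char_poly_hom[OF B])
  moreover have "monic (char_poly B)"
    using degree_monic_char_poly[OF B] by simp
  ultimately show ?thesis by blast
qed

text \<open>Views the field as a Z-module, so that \<open>int_module.span V\<close> is the additive
  group generated by \<open>V\<close>.\<close>

interpretation int_module: Modules.module "\<lambda>(n::int) (x::'a::field_char_0). of_int n * x"
  by unfold_locales (auto simp: algebra_simps)

lemma algebraic_int_if_finite_stable:
  fixes x :: "'a::field_char_0"
  assumes "finite V" "1 \<in> V" and "\<And>v. v \<in> V \<Longrightarrow> x * v \<in> int_module.span V"
  shows "algebraic_int x"
proof -
  have "\<exists>p. monic p \<and> poly (map_poly of_int p) x = 0"
  proof (rule root_of_monic_poly_if_finite_stable)
    show "comm_ring_hom (of_int :: int \<Rightarrow> 'a)"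
      by unfold_locales auto
    show "\<exists>c. x * v = (\<Sum>w\<in>V. of_int (c w) * w)" if "v \<in> V" for v
      using assms(3)[OF that] by (auto simp: int_module.span_finite[OF \<open>finite V\<close>])
  qed (use assms in auto)
  then show ?thesis by (auto simp: algebraic_int_altdef_ipoly)
qed

lemma mult_span_subset:
  fixes x :: "'a::field_char_0"
  assumes "\<And>v. v \<in> V \<Longrightarrow> x * v \<in> int_module.span W" and "u \<in> int_module.span V"
  shows "x * u \<in> int_module.span W"
  using assms(2)
proof (induction rule: int_module.span_induct_alt)
  case (step c v y)
  have "x * (of_int c * v + y) = of_int c * (x * v) + x * y"
    by (simp add: algebra_simps)
  then show ?case
    using step assms(1) by (auto intro: int_module.span_add int_module.span_scale)
qed (auto intro: int_module.span_zero)

lemma algebraic_int_power_relation: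
  fixes x :: "'a::field_char_0"
  assumes "algebraic_int x"
  obtains n c where "n > 0" "x ^ n = (\<Sum>i<n. of_int (c i) * x ^ i)"
proof -
  obtain p where p: "poly (map_poly of_int p) x = 0" "monic p"
    using assms by (auto simp: algebraic_int_altdef_ipoly)
  define n where "n = degree p"
  have "0 = (\<Sum>i\<le>n. of_int (coeff p i) * x ^ i)"
    using p(1) by (simp add: poly_altdef degree_map_poly coeff_map_poly n_def)
  also have "\<dots> = x ^ n + (\<Sum>i<n. of_int (coeff p i) * x ^ i)"
    using p(2) by (simp add: n_def flip: lessThan_Suc_atMost)
  finally have "x ^ n = (\<Sum>i<n. of_int (- coeff p i) * x ^ i)"
    by (simp add: sum_negf eq_neg_iff_add_eq_0)
  \<comment> \<open>For \<open>n = 0\<close> the sum is empty and the relation would read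
    \<open>1 = 0\<close>.\<close>
  moreover from this have "n > 0" by (intro Nat.gr0I) auto
  ultimately show ?thesis using that[of n "\<lambda>i. - coeff p i"] by simp
qed

text \<open>The group generated by the monomials \<open>x ^ i * y ^ j\<close> below the two degrees
  is stable under both elements, since the relations reduce the top powers. Stability then passes to
  \<open>x + y\<close> and \<open>x * y\<close>, which makes the algebraic integers a ring.\<close>

lemma algebraic_int_common_module:
  fixes x y :: "'a::field_char_0"
  assumes "algebraic_int x" "algebraic_int y"
  obtains V where "finite V" "1 \<in> V"
    "\<And>v. v \<in> V \<Longrightarrow> x * v \<in> int_module.span V" "\<And>v. v \<in> V \<Longrightarrow> y * v \<in> int_module.span V"
proof -
  obtain m c where m: "m > 0" "x ^ m = (\<Sum>i<m. of_int (c i) * x ^ i)"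
    using algebraic_int_power_relation[OF assms(1)] .
  obtain n d where n: "n > 0" "y ^ n = (\<Sum>i<n. of_int (d i) * y ^ i)"
    using algebraic_int_power_relation[OF assms(2)] .
  define V where "V = (\<lambda>(i, j). x ^ i * y ^ j) ` ({..<m} \<times> {..<n})"
  have V: "x ^ i * y ^ j \<in> int_module.span V" if "i < m" "j < n" for i j
    using that by (intro int_module.span_base) (auto simp: V_def)
  show ?thesis
  proof
    show "finite V" by (simp add: V_def)
    show "1 \<in> V"
      using m(1) n(1) unfolding V_def by (intro image_eqI[of _ _ "(0, 0)"]) auto
  next
    fix v assume "v \<in> V"
    then obtain i j where ij: "i < m" "j < n" "v = x ^ i * y ^ j" by (auto simp: V_def)
    show "x * v \<in> int_module.span V"
    proof (cases "Suc i < m")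
      case True
      then show ?thesis using V[of "Suc i" j] ij by (simp add: mult_ac)
    next
      case False
      then have "m = Suc i" using ij by simp
      then have "x * v = x ^ m * y ^ j" using ij by simp
      also have "\<dots> = (\<Sum>k<m. of_int (c k) * (x ^ k * y ^ j))"
        unfolding m(2) by (simp add: sum_distrib_right mult.assoc)
      finally show ?thesis
        using V ij by (auto intro!: int_module.span_sum int_module.span_scale)
    qed
    show "y * v \<in> int_module.span V"
    proof (cases "Suc j < n")
      case True
      then show ?thesis using V[of i "Suc j"] ij by (simp add: mult_ac)
    next
      case False
      then have "n = Suc j" using ij by simp
      then have "y * v = x ^ i * y ^ n" using ij by simp
      also have "\<dots> = (\<Sum>k<n. of_int (d k) * (x ^ i * y ^ k))"
        unfolding n(2) by (simp add: sum_distrib_left mult.left_commute)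
      finally show ?thesis
        using V ij by (auto intro!: int_module.span_sum int_module.span_scale)
    qed
  qed
qed

lemma algebraic_int_plus:
  fixes x y :: "'a::field_char_0"
  assumes "algebraic_int x" "algebraic_int y"
  shows "algebraic_int (x + y)"
proof -
  obtain V where V: "finite V" "1 \<in> V"
    "\<And>v. v \<in> V \<Longrightarrow> x * v \<in> int_module.span V" "\<And>v. v \<in> V \<Longrightarrow> y * v \<in> int_module.span V"
    using algebraic_int_common_module[OF assms] by blast
  show ?thesis
    by (rule algebraic_int_if_finite_stable[of V])
      (auto simp: distrib_right intro!: int_module.span_add V)
qed

lemma algebraic_int_times:
  fixes x y :: "'a::field_char_0"
  assumes "algebraic_int x" "algebraic_int y"
  shows "algebraic_int (x * y)"
proof -
  obtain V where V: "finite V" "1 \<in> V"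
    "\<And>v. v \<in> V \<Longrightarrow> x * v \<in> int_module.span V" "\<And>v. v \<in> V \<Longrightarrow> y * v \<in> int_module.span V"
    using algebraic_int_common_module[OF assms] by blast
  show ?thesis
    by (rule algebraic_int_if_finite_stable[of V])
      (simp_all add: mult.assoc V(1,2) mult_span_subset[of V x V, OF V(3)] V(4))
qed

lemma algebraic_int_prod:
  fixes f :: "'b \<Rightarrow> 'a::field_char_0"
  assumes "\<And>i. i \<in> A \<Longrightarrow> algebraic_int (f i)"
  shows "algebraic_int (prod f A)"
  using assms by (induction A rule: infinite_finite_induct) (auto intro: algebraic_int_times int_imp_algebraic_int)

section \<open>Comaximal denominators of an algebraic number\<close>

lemma int_ideal_principal:
  fixes J :: "int set"
  assumes "0 \<in> J" and add: "\<And>a b. a \<in> J \<Longrightarrow> b \<in> J \<Longrightarrow> a + b \<in> J"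
    and mult: "\<And>a k. a \<in> J \<Longrightarrow> k * a \<in> J"
  obtains g where "J = {n. g dvd n}"
proof (cases "J \<subseteq> {0}")
  case True
  then have "J = {n. 0 dvd n}" using assms(1) by auto
  then show ?thesis by (rule that)
next
  case False
  then obtain a where a: "a \<in> J" "a \<noteq> 0" by auto
  have "\<exists>m::nat. m > 0 \<and> int m \<in> J"
  proof (cases "a > 0")
    case True
    then show ?thesis using a by (intro exI[of _ "nat a"]) auto
  next
    case False
    then show ?thesis using a mult[of a "-1"] by (intro exI[of _ "nat (-a)"]) auto
  qed
  \<comment> \<open>The least positive element of \<open>J\<close> is the generator: a remainder
    modulo \<open>g\<close> of an element of \<open>J\<close> lies in \<open>J\<close> and is
    smaller, so it vanishes.\<close>
  then obtain g :: nat where g: "g > 0" "int g \<in> J"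
    and min: "\<And>m. m < g \<Longrightarrow> \<not> (m > 0 \<and> int m \<in> J)"
    using exists_least_iff[of "\<lambda>m. m > 0 \<and> int m \<in> J"] by blast
  have "int g dvd n" if "n \<in> J" for n
  proof (rule ccontr)
    assume "\<not> int g dvd n"
    then have "n mod int g \<noteq> 0" by (simp add: dvd_eq_mod_eq_0)
    moreover have "n mod int g = n + (- (n div int g)) * int g"
      by (simp add: minus_div_mult_eq_mod)
    then have "n mod int g \<in> J" using that g add mult by metis
    moreover have "0 \<le> n mod int g" "n mod int g < int g" using g by auto
    ultimately have "nat (n mod int g) < g" "nat (n mod int g) > 0" "int (nat (n mod int g)) \<in> J"
      using \<open>n mod int g \<in> J\<close> by auto
    then show False using min by blast
  qed
  moreover have "n \<in> J" if "int g dvd n" for n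
    using that mult[OF g(2)] by (auto simp: dvd_def mult.commute)
  ultimately have "J = {n. int g dvd n}" by auto
  then show ?thesis by (rule that)
qed

text \<open>Dividing an annihilating polynomial by its nonzero content keeps the root. Content 1
  later forces an ideal of integers that contains all coefficients to be the unit ideal.\<close>

lemma primitive_int_poly_root:
  fixes x :: "'a::field_char_0"
  assumes "algebraic x"
  obtains p where "poly (map_poly of_int p) x = 0" "content p = 1"
proof -
  obtain q where q: "q \<noteq> 0" "poly (map_poly of_int q) x = 0"
    using assms by (erule algebraicE')
  define p where "p = primitive_part q"
  have "map_poly of_int q = Polynomial.smult (of_int (content q)) (map_poly of_int p :: 'a poly)"
    unfolding p_def
    by (subst content_times_primitive_part[of q, symmetric], rule poly_eqI)
      (simp add: coeff_map_poly del: content_times_primitive_part)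
  then have "poly (map_poly of_int p) x = 0" using q by auto
  moreover have "content p = 1" using q by (simp add: p_def)
  ultimately show ?thesis by (rule that)
qed

text \<open>
  Multiplication by this Horner quotient maps the group spanned by \<open>1, x, \<dots>, x^(n-1)\<close> to itself.
\<close>

lemma horner_quotient_algebraic_int:
  fixes x :: "'a::field_char_0" and a :: "nat \<Rightarrow> int"
  assumes root: "(\<Sum>i\<le>n. of_int (a i) * x ^ i) = 0" and "m \<le> n"
  shows "algebraic_int (\<Sum>i=m..n. of_int (a i) * x ^ (i - m))"
proof (cases "m = 0")
  case True
  then show ?thesis using root by (simp add: atMost_atLeast0)
next
  case False
  define s where "s = (\<Sum>i=m..n. of_int (a i) * x ^ (i - m))"
  define V where "V = (\<lambda>j. x ^ j) ` {..<n}"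
  have V: "x ^ j \<in> int_module.span V" if "j < n" for j
    using that by (intro int_module.span_base) (auto simp: V_def)
  \<comment> \<open>The vanishing sum is cut at exponent \<open>m\<close>: its upper part is
    \<open>x ^ m * s\<close>, which therefore equals minus the lower part.\<close>
  have "x ^ m * s = (\<Sum>i=m..n. of_int (a i) * x ^ i)"
    unfolding s_def sum_distrib_left
    by (rule sum.cong) (auto simp: power_diff_conv_inverse mult.left_commute simp flip: power_add)
  moreover have "{..n} = {..<m} \<union> {m..n}" using \<open>m \<le> n\<close> by auto
  then have "0 = (\<Sum>i<m. of_int (a i) * x ^ i) + (\<Sum>i=m..n. of_int (a i) * x ^ i)"
    unfolding root[symmetric] by (simp only:) (subst sum.union_disjoint, auto)
  ultimately have low: "x ^ m * s = - (\<Sum>i<m. of_int (a i) * x ^ i)"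
    by (simp add: eq_neg_iff_add_eq_0 add.commute)
  have "algebraic_int s"
  proof (rule algebraic_int_if_finite_stable[of V])
    show "finite V" "1 \<in> V"
      using False \<open>m \<le> n\<close> by (auto simp: V_def intro!: image_eqI[of _ _ 0])
  next
    fix v assume "v \<in> V"
    then obtain j where j: "j < n" "v = x ^ j" by (auto simp: V_def)
    show "s * v \<in> int_module.span V"
    proof (cases "j < m")
      case True
      \<comment> \<open>For \<open>j < m\<close> the direct expansion has exponents at most
        \<open>n - m + j\<close>, which is below \<open>n\<close>.\<close>
      have "s * v = (\<Sum>i=m..n. of_int (a i) * x ^ (i - m + j))"
        by (simp add: s_def j(2) sum_distrib_right power_add mult.assoc del: Nat.add_diff_assoc2)
      also have "\<dots> \<in> int_module.span V"
        using True \<open>m \<le> n\<close> by (intro int_module.span_sum int_module.span_scale V) auto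
      finally show ?thesis .
    next
      case False
      \<comment> \<open>For \<open>j \<ge> m\<close> the factor \<open>x ^ m\<close> is available,
        and the lower part gives exponents \<open>i + (j - m)\<close> with \<open>i < m\<close>,
        hence below \<open>j\<close>.\<close>
      then have "s * v = x ^ (j - m) * (x ^ m * s)"
        by (simp add: j mult_ac flip: power_add)
      also have "\<dots> = - (\<Sum>i<m. of_int (a i) * x ^ (i + (j - m)))"
        unfolding low by (simp add: sum_distrib_left power_add mult_ac)
      also have "\<dots> \<in> int_module.span V"
        using False j by (intro int_module.span_neg int_module.span_sum int_module.span_scale V) auto
      finally show ?thesis .
    qed
  qed
  then show ?thesis by (simp add: s_def)
qed

text \<open>The integers of the form \<open>d + e * x\<close> with \<open>d\<close> and
  \<open>e\<close> in \<open>D\<close> form an ideal of the integers. It contains every coefficient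
  of a primitive polynomial with root \<open>x\<close>, so its generator divides the content
  1.\<close>

lemma algebraic_denominators_comaximal:
  fixes x :: "'a::field_char_0"
  assumes "algebraic x"
  obtains d e where "algebraic_int d" "algebraic_int (d * x)" "algebraic_int e" "algebraic_int (e * x)"
    "d + e * x = 1"
proof -
  define D where "D = {d. algebraic_int d \<and> algebraic_int (d * x)}"
  have D_add: "d + e \<in> D" if "d \<in> D" "e \<in> D" for d e
    using that by (auto simp: D_def distrib_right intro: algebraic_int_plus)
  have D_mult: "of_int k * d \<in> D" if "d \<in> D" for d k
    using that by (auto simp: D_def mult.assoc intro: algebraic_int_times int_imp_algebraic_int)
  obtain p where p: "poly (map_poly of_int p) x = 0" "content p = 1"
    using primitive_int_poly_root[OF assms] .
  define n where "n = degree p"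
  define s where "s m = (\<Sum>i=m..n. of_int (coeff p i) * x ^ (i - m))" for m
  have root: "(\<Sum>i\<le>n. of_int (coeff p i) * x ^ i) = 0"
    using p(1) by (simp add: poly_altdef degree_map_poly coeff_map_poly n_def)
  have s_rec: "s m = of_int (coeff p m) + x * s (Suc m)" if "m \<le> n" for m
  proof -
    have "s m = of_int (coeff p m) + (\<Sum>i=Suc m..n. of_int (coeff p i) * x ^ (i - m))"
      unfolding s_def using that by (subst sum.atLeast_Suc_atMost) auto
    also have "(\<Sum>i=Suc m..n. of_int (coeff p i) * x ^ (i - m)) = x * s (Suc m)"
      unfolding s_def sum_distrib_left
      by (rule sum.cong) (auto simp: Suc_diff_Suc mult_ac simp flip: power_Suc)
    finally show ?thesis .
  qed
  have s_int: "algebraic_int (s m)" if "m \<le> n" for m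
    unfolding s_def by (rule horner_quotient_algebraic_int[OF root that])
  \<comment> \<open>Both ends vanish, \<open>s 0\<close> by the root equation and
    \<open>s (Suc n)\<close> as an empty sum. In between, \<open>s m * x\<close> differs from the
    previous Horner quotient by an integer.\<close>
  have sD: "s m \<in> D" if "m \<le> Suc n" for m
  proof (cases m)
    case 0
    then have "s m = 0" using root by (simp add: s_def atMost_atLeast0)
    then show ?thesis by (simp add: D_def)
  next
    case (Suc k)
    show ?thesis
    proof (cases "m = Suc n")
      case True
      then have "s m = 0" by (simp add: s_def)
      then show ?thesis by (simp add: D_def)
    next
      case False
      then have m: "k \<le> n" "m \<le> n" using Suc that by auto
      have "s m * x = s k + of_int (- coeff p k)"
        using s_rec[OF m(1)] Suc by (simp add: mult.commute)
      then show ?thesis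
        using s_int m by (auto simp: D_def simp del: of_int_minus
          intro: algebraic_int_plus int_imp_algebraic_int)
    qed
  qed
  define J where "J = {k::int. \<exists>d\<in>D. \<exists>e\<in>D. of_int k = d + e * x}"
  have "0 \<in> J"
    by (auto simp: J_def D_def intro!: exI[of _ 0])
  have "k + l \<in> J" if kl: "k \<in> J" "l \<in> J" for k l
  proof -
    obtain d e d' e' where "d \<in> D" "e \<in> D" "d' \<in> D" "e' \<in> D"
      "of_int k = d + e * x" "of_int l = d' + e' * x"
      using kl by (auto simp: J_def)
    then have "d + d' \<in> D" "e + e' \<in> D" "of_int (k + l) = (d + d') + (e + e') * x"
      using D_add by (auto simp: algebra_simps)
    then show ?thesis by (auto simp: J_def)
  qed
  moreover have "l * k \<in> J" if k: "k \<in> J" for k l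
  proof -
    obtain d e where "d \<in> D" "e \<in> D" "of_int k = d + e * x"
      using k by (auto simp: J_def)
    then have "of_int l * d \<in> D" "of_int l * e \<in> D" "of_int (l * k) = of_int l * d + of_int l * e * x"
      using D_mult by (auto simp: algebra_simps)
    then show ?thesis unfolding J_def by blast
  qed
  ultimately obtain g where g: "J = {k. g dvd k}"
    using int_ideal_principal \<open>0 \<in> J\<close> by blast
  have "coeff p m \<in> J" for m
  proof (cases "m \<le> n")
    case True
    \<comment> \<open>The Horner recursion solved for the coefficient, with \<open>d = s m\<close>
      and \<open>e = - s (Suc m)\<close>.\<close>
    have "of_int (coeff p m) = s m + of_int (-1) * s (Suc m) * x"
      using s_rec[OF True] by (simp add: mult.commute)
    moreover have "s m \<in> D" "of_int (-1) * s (Suc m) \<in> D"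
      using sD[of m] D_mult[OF sD[of "Suc m"], of "-1"] True by simp_all
    ultimately show ?thesis unfolding J_def by blast
  next
    case False
    then show ?thesis using \<open>0 \<in> J\<close> by (simp add: n_def coeff_eq_0)
  qed
  then have "g dvd coeff p m" for m using g by auto
  then have "g dvd content p" by (simp add: const_poly_dvd_iff_dvd_content[symmetric] const_poly_dvd_iff)
  then have "1 \<in> J" using g p(2) by auto
  then show ?thesis using that by (auto simp: J_def D_def)
qed

subsection \<open>Ideals of subrings of a field\<close>

lemma ring_of_type_algebra_simps [simp]:
  "carrier ring_of_type_algebra = UNIV" "x \<otimes>\<^bsub>ring_of_type_algebra\<^esub> y = x * y"
  "x \<oplus>\<^bsub>ring_of_type_algebra\<^esub> y = x + y"
  "\<one>\<^bsub>ring_of_type_algebra\<^esub> = 1" "\<zero>\<^bsub>ring_of_type_algebra\<^esub> = 0"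
  by (simp_all add: ring_of_type_algebra_def)

lemma subring_type_iff:
  "subring S (ring_of_type_algebra :: 'k::field_char_0 ring) \<longleftrightarrow>
    1 \<in> S \<and> (\<forall>x\<in>S. - x \<in> S) \<and> (\<forall>x\<in>S. \<forall>y\<in>S. x + y \<in> S \<and> x * y \<in> S)"
    (is "subring S ?K \<longleftrightarrow> ?R")
proof -
  interpret K: Ring.ring ?K by (rule ring_from_type_algebra)
  have minus: "\<ominus>\<^bsub>?K\<^esub> x = - x" for x
    by (rule K.minus_equality) simp_all
  show ?thesis
  proof
    assume "subring S ?K"
    from subringE[OF this] show ?R
      unfolding minus by auto
  next
    assume ?R
    then show "subring S ?K"
      by (intro K.subringI) (simp_all add: minus)
  qed
qed

lemma subringD:
  assumes "subring S (ring_of_type_algebra :: 'k::field_char_0 ring)"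
  shows "1 \<in> S" "0 \<in> S" "x \<in> S \<Longrightarrow> - x \<in> S" "x \<in> S \<Longrightarrow> y \<in> S \<Longrightarrow> x + y \<in> S"
    "x \<in> S \<Longrightarrow> y \<in> S \<Longrightarrow> x * y \<in> S" "of_int k \<in> S"
proof -
  show *: "1 \<in> S" "x \<in> S \<Longrightarrow> - x \<in> S" "x \<in> S \<Longrightarrow> y \<in> S \<Longrightarrow> x + y \<in> S"
    "x \<in> S \<Longrightarrow> y \<in> S \<Longrightarrow> x * y \<in> S" for x y
    using assms by (auto simp: subring_type_iff)
  show "0 \<in> S" using *(3)[OF *(1) *(2)[OF *(1)]] by simp
  have nat: "of_nat n \<in> S" for n
    using \<open>0 \<in> S\<close> by (induction n) (auto intro: *)
  show "of_int k \<in> S"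
    by (cases k) (use nat *(2)[OF nat] in \<open>auto simp del: of_nat_Suc\<close>)
qed

lemma cring_subring_of:
  assumes "subring S (ring_of_type_algebra :: 'k::field_char_0 ring)"
  shows "cring (subring_of S)"
proof -
  interpret K: cring "ring_of_type_algebra :: 'k ring" by (rule cring_from_type_algebra)
  show ?thesis
    using K.subcringI'[OF assms] K.subcring_iff[of S] subringE(1)[OF assms] by simp
qed

lemma ideal_subring_of_iff:
  assumes S: "subring S (ring_of_type_algebra :: 'k::field_char_0 ring)"
  shows "ideal I (subring_of S) \<longleftrightarrow>
    I \<subseteq> S \<and> 0 \<in> I \<and> (\<forall>a\<in>I. \<forall>b\<in>I. a + b \<in> I) \<and> (\<forall>r\<in>S. \<forall>a\<in>I. r * a \<in> I)"
    (is "_ \<longleftrightarrow> ?R")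
proof -
  interpret S: cring "subring_of S" by (rule cring_subring_of[OF S])
  have "?R" if "ideal I (subring_of S)"
  proof -
    interpret I: ideal I "subring_of S" by fact
    show ?R
    proof (intro conjI ballI)
      show "I \<subseteq> S" "0 \<in> I" using I.a_subset I.zero_closed by simp_all
      show "a + b \<in> I" if "a \<in> I" "b \<in> I" for a b using I.a_closed[OF that] by simp
      show "r * a \<in> I" if "r \<in> S" "a \<in> I" for r a using I.I_l_closed[of a r] that by simp
    qed
  qed
  moreover have "ideal I (subring_of S)" if R: ?R
  proof (rule idealI)
    show "Ring.ring (subring_of S)" by (rule S.ring_axioms)
    show "subgroup I (add_monoid (subring_of S))"
    proof (rule S.add.subgroupI)
      show "\<ominus>\<^bsub>subring_of S\<^esub> a \<in> I" if a: "a \<in> I" for a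
      proof -
        have "a \<in> S" using R a by blast
        then have "\<ominus>\<^bsub>subring_of S\<^esub> a = - a"
          using subringD(3)[OF S] by (intro S.minus_equality) simp_all
        \<comment> \<open>Negation is multiplication by \<open>- 1\<close>, an element of
          \<open>S\<close>.\<close>
        moreover have "- 1 * a \<in> I"
          using R a subringD(3)[OF S subringD(1)[OF S]] by blast
        ultimately show ?thesis by simp
      qed
    qed (use R in auto)
    show "x \<otimes>\<^bsub>subring_of S\<^esub> a \<in> I" "a \<otimes>\<^bsub>subring_of S\<^esub> x \<in> I"
      if "a \<in> I" "x \<in> carrier (subring_of S)" for a x
      using R that by (auto simp: mult.commute[of a x])
  qed
  ultimately show ?thesis by blast
qed

lemma primeideal_subring_of_iff:
  assumes S: "subring S (ring_of_type_algebra :: 'k::field_char_0 ring)"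
  shows "primeideal P (subring_of S) \<longleftrightarrow>
    ideal P (subring_of S) \<and> 1 \<notin> P \<and> (\<forall>a\<in>S. \<forall>b\<in>S. a * b \<in> P \<longrightarrow> a \<in> P \<or> b \<in> P)"
    (is "_ \<longleftrightarrow> ?R")
proof
  assume "primeideal P (subring_of S)"
  then interpret P: primeideal P "subring_of S" .
  show ?R
    using P.ideal_axioms P.I_notcarr P.I_prime P.one_imp_carrier by auto
next
  assume R: ?R
  then have "P \<noteq> S" using subringD(1)[OF S] by auto
  then show "primeideal P (subring_of S)"
    using R cring_subring_of[OF S] by (intro primeidealI) auto
qed

section \<open>Prime ideals: avoidance, existence, extension and contraction\<close>

lemma primeidealD:
  assumes S: "subring S (ring_of_type_algebra :: 'k::field_char_0 ring)"
    and P: "primeideal P (subring_of S)"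
  shows "P \<subseteq> S" "0 \<in> P" "1 \<notin> P" "a \<in> P \<Longrightarrow> b \<in> P \<Longrightarrow> a + b \<in> P"
    "r \<in> S \<Longrightarrow> a \<in> P \<Longrightarrow> r * a \<in> P" "a \<in> S \<Longrightarrow> b \<in> S \<Longrightarrow> a * b \<in> P \<Longrightarrow> a \<in> P \<or> b \<in> P"
  using P unfolding primeideal_subring_of_iff[OF S] ideal_subring_of_iff[OF S] by blast+

lemma primeideal_prodD:
  assumes S: "subring S (ring_of_type_algebra :: 'k::field_char_0 ring)"
    and P: "primeideal P (subring_of S)"
    and "finite A" "\<And>i. i \<in> A \<Longrightarrow> f i \<in> S" "prod f A \<in> P"
  shows "\<exists>i\<in>A. f i \<in> P"
proof -
  \<comment> \<open>Membership in \<open>S\<close> is carried through the induction because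
    primality of \<open>P\<close> only speaks about factors in \<open>S\<close>.\<close>
  have "prod f A \<in> S \<and> (prod f A \<in> P \<longrightarrow> (\<exists>i\<in>A. f i \<in> P))"
    using assms(3,4)
  proof (induction A)
    case empty
    then show ?case using subringD(1)[OF S] primeidealD(3)[OF S P] by simp
  next
    case (insert i A)
    then show ?case
      using subringD(5)[OF S, of "f i" "prod f A"] primeidealD(6)[OF S P, of "f i" "prod f A"] by auto
  qed
  then show ?thesis using assms(5) by blast
qed

text \<open>A redundant member of the cover is dropped by induction. If none is redundant, each
  \<open>F i\<close> owns an element \<open>y i\<close> of \<open>Q\<close> outside all the others;
  for a cover of at least two members, adding to \<open>y i\<close> the product of the remaining
  ones gives an element of \<open>Q\<close> in no member of the cover.\<close>

lemma prime_avoidance: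
  assumes S: "subring S (ring_of_type_algebra :: 'k::field_char_0 ring)"
    and Q: "ideal Q (subring_of S)" and "finite A"
    and "\<And>i. i \<in> A \<Longrightarrow> primeideal (F i) (subring_of S)" and "Q \<subseteq> (\<Union>i\<in>A. F i)"
  shows "\<exists>i\<in>A. Q \<subseteq> F i"
  using assms(3-)
proof (induction A rule: finite_psubset_induct)
  case (psubset A)
  note F = primeidealD[OF S psubset.prems(1)]
  have Q': "Q \<subseteq> S" "0 \<in> Q" "\<And>a b. a \<in> Q \<Longrightarrow> b \<in> Q \<Longrightarrow> a + b \<in> Q" "\<And>r a. r \<in> S \<Longrightarrow> a \<in> Q \<Longrightarrow> r * a \<in> Q"
    using Q unfolding ideal_subring_of_iff[OF S] by auto
  show ?case
  proof (cases "\<exists>i\<in>A. Q \<subseteq> (\<Union>j\<in>A - {i}. F j)")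
    case True
    then obtain i where i: "i \<in> A" "Q \<subseteq> (\<Union>j\<in>A - {i}. F j)" by blast
    have "\<exists>j\<in>A - {i}. Q \<subseteq> F j"
      using i psubset.prems(1) by (intro psubset.IH) auto
    then show ?thesis by blast
  next
    case False
    then have "\<forall>i\<in>A. \<exists>y. y \<in> Q \<and> (\<forall>j\<in>A - {i}. y \<notin> F j)" by blast
    then obtain y where y: "\<And>i. i \<in> A \<Longrightarrow> y i \<in> Q" "\<And>i j. i \<in> A \<Longrightarrow> j \<in> A \<Longrightarrow> j \<noteq> i \<Longrightarrow> y i \<notin> F j"
      by (metis Diff_iff singletonD)
    have yF: "y i \<in> F i" if "i \<in> A" for i
      using y[OF that] psubset.prems(2) that by blast
    obtain i where i: "i \<in> A" using psubset.prems(2) Q'(2) by blast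
    show ?thesis
    proof (cases "A = {i}")
      case True
      then show ?thesis using psubset.prems(2) by auto
    next
      case False
      \<comment> \<open>The product lies in every \<open>F j\<close> with
        \<open>j \<noteq> i\<close>, and in \<open>Q\<close> because \<open>A - {i}\<close> is
        nonempty, but not in \<open>F i\<close> by primality.\<close>
      define z where "z = prod y (A - {i})"
      have yS: "y j \<in> S" if "j \<in> A" for j using y(1)[OF that] Q'(1) by blast
      have prod_S: "prod y B \<in> S" if "B \<subseteq> A" for B
        using finite_subset[OF that psubset.hyps] that
        by (induction B) (auto intro: subringD[OF S] yS)
      have zF: "z \<in> F j \<and> z \<in> Q" if "j \<in> A" "j \<noteq> i" for j
      proof -
        have "z = prod y (A - {i} - {j}) * y j"
          unfolding z_def using that psubset.hyps by (subst prod.remove[of _ j]) (auto simp: mult.commute)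
        moreover have "prod y (A - {i} - {j}) \<in> S" by (rule prod_S) auto
        ultimately show ?thesis
          using F(5)[OF that(1)] Q'(4) yF[OF that(1)] y(1)[OF that(1)] by simp
      qed
      then have "z \<in> Q" using False i by blast
      have "z \<notin> F i"
      proof
        assume "z \<in> F i"
        then obtain j where "j \<in> A - {i}" "y j \<in> F i"
          using primeideal_prodD[OF S psubset.prems(1)[OF i], of "A - {i}" y] psubset.hyps yS
          unfolding z_def by auto
        then show False using y(2)[of j i] i by auto
      qed
      have minus: "- 1 \<in> S" using subringD[OF S] by blast
      have "y i + z \<in> Q" using y(1)[OF i] \<open>z \<in> Q\<close> Q'(3) by blast
      then obtain j where j: "j \<in> A" "y i + z \<in> F j" using psubset.prems(2) by blast
      show ?thesis
      \<comment> \<open>Subtracting the summand known to lie in \<open>F j\<close> leaves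
        \<open>z\<close> in \<open>F i\<close> or \<open>y i\<close> in \<open>F j\<close>, and both
        are excluded.\<close>
      proof (cases "j = i")
        case True
        have "(y i + z) + - 1 * y i \<in> F i"
          using j True F(4)[OF i _ F(5)[OF i minus yF[OF i]], of "y i + z"] by blast
        then show ?thesis using \<open>z \<notin> F i\<close> by simp
      next
        case False
        have "(y i + z) + - 1 * z \<in> F j"
          using zF[OF j(1) False] F(4)[OF j(1) j(2) F(5)[OF j(1) minus, of z]] by blast
        then show ?thesis using y(2)[OF i j(1) False] by simp
      qed
    qed
  qed
qed

text \<open>Zorn's lemma gives an ideal maximal among those containing \<open>I\<close> and avoiding
  1, and such an ideal is prime.\<close>

lemma ideal_subset_primeideal:
  assumes S: "subring S (ring_of_type_algebra :: 'k::field_char_0 ring)"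
    and I: "ideal I (subring_of S)" "1 \<notin> I"
  obtains M where "primeideal M (subring_of S)" "I \<subseteq> M"
proof -
  note id_iff = ideal_subring_of_iff[OF S]
  define \<J> where "\<J> = {N. ideal N (subring_of S) \<and> I \<subseteq> N \<and> 1 \<notin> N}"
  have "\<exists>M\<in>\<J>. \<forall>N\<in>\<J>. M \<subseteq> N \<longrightarrow> N = M"
  proof (rule subset_Zorn_nonempty)
    show "\<J> \<noteq> {}" using I by (auto simp: \<J>_def)
  next
    fix C assume C: "C \<noteq> {}" "subset.chain \<J> C"
    then have CA: "C \<subseteq> \<J>" and tot: "\<And>N L. N \<in> C \<Longrightarrow> L \<in> C \<Longrightarrow> N \<subseteq> L \<or> L \<subseteq> N"
      by (auto simp: subset.chain_def)
    have id: "N \<subseteq> S" "0 \<in> N" "\<And>a b. a \<in> N \<Longrightarrow> b \<in> N \<Longrightarrow> a + b \<in> N"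
      "\<And>r a. r \<in> S \<Longrightarrow> a \<in> N \<Longrightarrow> r * a \<in> N" "I \<subseteq> N" "1 \<notin> N" if "N \<in> C" for N
      using that CA unfolding \<J>_def id_iff by blast+
    obtain N0 where N0: "N0 \<in> C" using C(1) by blast
    have "a + b \<in> \<Union>C" if ab: "a \<in> \<Union>C" "b \<in> \<Union>C" for a b
    proof -
      obtain N L where NL: "N \<in> C" "L \<in> C" "a \<in> N" "b \<in> L" using ab by blast
      with tot[OF NL(1,2)] id(3) show ?thesis by blast
    qed
    moreover have "\<Union>C \<subseteq> S" using id(1) by (rule Union_least)
    moreover have "0 \<in> \<Union>C" using id(2)[OF N0] N0 by (rule UnionI[rotated])
    moreover have "I \<subseteq> \<Union>C" using id(5)[OF N0] Union_upper[OF N0] by (rule order_trans)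
    moreover have "1 \<notin> \<Union>C" using id(6) by (meson UnionE)
    moreover have "r * a \<in> \<Union>C" if "r \<in> S" "a \<in> \<Union>C" for r a
      using that(2) id(4)[OF _ that(1)] by (meson UnionE UnionI)
    ultimately show "\<Union>C \<in> \<J>" unfolding \<J>_def id_iff by simp
  qed
  then obtain M where M_in: "M \<in> \<J>" and M_max: "\<And>N. N \<in> \<J> \<Longrightarrow> M \<subseteq> N \<Longrightarrow> N = M" by auto
  have M: "ideal M (subring_of S)" "I \<subseteq> M" "1 \<notin> M"
    using M_in by (simp_all add: \<J>_def)
  have max: "N = M" if "ideal N (subring_of S)" "M \<subseteq> N" "1 \<notin> N" for N
    using that M(2) by (intro M_max) (auto simp: \<J>_def)
  have M': "M \<subseteq> S" "0 \<in> M" "\<And>a b. a \<in> M \<Longrightarrow> b \<in> M \<Longrightarrow> a + b \<in> M" "\<And>r a. r \<in> S \<Longrightarrow> a \<in> M \<Longrightarrow> r * a \<in> M"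
    using M(1) unfolding id_iff by blast+
  have "b \<in> M" if ab: "a \<in> S" "b \<in> S" "a * b \<in> M" "a \<notin> M" for a b
  proof -
    \<comment> \<open>The ideal \<open>M + a S\<close> properly contains \<open>M\<close> because of
      \<open>a\<close>, so maximality puts 1 in it; multiplying \<open>1 = m + r * a\<close> by
      \<open>b\<close> then expresses \<open>b\<close> through elements of \<open>M\<close>.\<close>
    define N where "N = {m + r * a |m r. m \<in> M \<and> r \<in> S}"
    have "M \<subseteq> N"
    proof
      fix m assume "m \<in> M"
      then show "m \<in> N" unfolding N_def
        using subringD(2)[OF S] by (intro CollectI exI[of _ m] exI[of _ 0]) auto
    qed
    moreover have "a \<in> N"
      unfolding N_def using subringD(1)[OF S] M'(2) by (intro CollectI exI[of _ 0] exI[of _ 1]) auto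
    moreover have "ideal N (subring_of S)"
      unfolding id_iff
    proof (intro conjI ballI)
      show "N \<subseteq> S" using M'(1) ab(1) subringD[OF S] by (auto simp: N_def)
      show "0 \<in> N" using \<open>M \<subseteq> N\<close> M'(2) by blast
    next
      fix u v assume "u \<in> N" "v \<in> N"
      then obtain m r m' r' where "u = m + r * a" "v = m' + r' * a" "m \<in> M" "m' \<in> M" "r \<in> S" "r' \<in> S"
        by (auto simp: N_def)
      then show "u + v \<in> N"
        unfolding N_def using M'(3) subringD(4)[OF S]
        by (intro CollectI exI[of _ "m + m'"] exI[of _ "r + r'"]) (auto simp: algebra_simps)
    next
      fix s u assume "s \<in> S" "u \<in> N"
      then obtain m r where "u = m + r * a" "m \<in> M" "r \<in> S" by (auto simp: N_def)
      then show "s * u \<in> N"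
        unfolding N_def using M'(4) subringD(5)[OF S] \<open>s \<in> S\<close>
        by (intro CollectI exI[of _ "s * m"] exI[of _ "s * r"]) (auto simp: distrib_left mult.assoc)
    qed
    ultimately have "1 \<in> N" using max[of N] ab(4) by metis
    then obtain m r where mr: "1 = m + r * a" "m \<in> M" "r \<in> S" by (auto simp: N_def)
    have "b = b * (m + r * a)" by (simp flip: mr(1))
    also have "\<dots> = b * m + r * (a * b)" by (simp add: distrib_left mult_ac)
    finally show ?thesis using M'(3)[OF M'(4)[OF ab(2) mr(2)] M'(4)[OF mr(3) ab(3)]] by simp
  qed
  then have "primeideal M (subring_of S)"
    using M(1,3) unfolding primeideal_subring_of_iff[OF S] by simp blast
  then show ?thesis using that M(2) by blast
qed

text \<open>A proper ideal lies in a prime, so the primes of \<open>S\<close> containing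
  \<open>P\<close> decide whether the extension is the whole ring. All later statements about
  extensions pass through this criterion instead of sums of generators.\<close>

lemma ext_ideal_eq_iff:
  assumes S: "subring S (ring_of_type_algebra :: 'k::field_char_0 ring)" and "P \<subseteq> S"
  shows "ext_ideal P S = S \<longleftrightarrow> (\<forall>M. primeideal M (subring_of S) \<longrightarrow> \<not> P \<subseteq> M)"
proof -
  interpret S: cring "subring_of S" by (rule cring_subring_of[OF S])
  have ext: "ideal (ext_ideal P S) (subring_of S)" "P \<subseteq> ext_ideal P S"
    using S.genideal_ideal[of P] S.genideal_self[of P] assms(2) unfolding ext_ideal_def by simp_all
  show ?thesis
  proof
    assume eq: "ext_ideal P S = S"
    show "\<forall>M. primeideal M (subring_of S) \<longrightarrow> \<not> P \<subseteq> M"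
    proof (intro allI impI notI)
      fix M assume M: "primeideal M (subring_of S)" "P \<subseteq> M"
      then have "ext_ideal P S \<subseteq> M"
        unfolding ext_ideal_def by (intro S.genideal_minimal primeideal.axioms(1))
      then show False using eq primeidealD(3)[OF S M(1)] subringD(1)[OF S] by blast
    qed
  next
    assume no_prime: "\<forall>M. primeideal M (subring_of S) \<longrightarrow> \<not> P \<subseteq> M"
    have "1 \<in> ext_ideal P S"
    proof (rule ccontr)
      assume "1 \<notin> ext_ideal P S"
      then obtain M where "primeideal M (subring_of S)" "ext_ideal P S \<subseteq> M"
        using ideal_subset_primeideal[OF S ext(1)] by blast
      then show False using no_prime ext(2) by blast
    qed
    then show "ext_ideal P S = S"
      using ideal.one_imp_carrier[OF ext(1)] by simp
  qed
qed

lemma primeideal_contract: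
  assumes S: "subring S (ring_of_type_algebra :: 'k::field_char_0 ring)" and T: "subring T ring_of_type_algebra"
    and "S \<subseteq> T" and M: "primeideal M (subring_of T)"
  shows "primeideal (M \<inter> S) (subring_of S)"
  unfolding primeideal_subring_of_iff[OF S] ideal_subring_of_iff[OF S]
proof (intro conjI ballI impI)
  show "0 \<in> M \<inter> S" using primeidealD(2)[OF T M] subringD(2)[OF S] by simp
  show "1 \<notin> M \<inter> S" using primeidealD(3)[OF T M] by simp
  show "a + b \<in> M \<inter> S" if "a \<in> M \<inter> S" "b \<in> M \<inter> S" for a b
    using that primeidealD(4)[OF T M] subringD(4)[OF S] by simp
  show "r * a \<in> M \<inter> S" if "r \<in> S" "a \<in> M \<inter> S" for r a
    using that primeidealD(5)[OF T M, of r a] subringD(5)[OF S, of r a] \<open>S \<subseteq> T\<close> by auto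
  show "a \<in> M \<inter> S \<or> b \<in> M \<inter> S" if "a \<in> S" "b \<in> S" "a * b \<in> M \<inter> S" for a b
    using that primeidealD(6)[OF T M, of a b] \<open>S \<subseteq> T\<close> by auto
qed simp

subsection \<open>The Galois group\<close>

lemma subring_ring_of_integers:
  "subring (ring_of_integers :: 'k::field_char_0 set) ring_of_type_algebra"
  unfolding subring_type_iff ring_of_integers_def
  by (auto intro: algebraic_int_plus algebraic_int_times)

lemma galD:
  fixes \<sigma> :: "'k::field_char_0 \<Rightarrow> 'k"
  assumes "\<sigma> \<in> gal"
  shows "bij \<sigma>" "\<sigma> (x + y) = \<sigma> x + \<sigma> y" "\<sigma> (x * y) = \<sigma> x * \<sigma> y" "\<sigma> 1 = 1"
    "\<sigma> (of_rat q) = of_rat q" "\<sigma> 0 = 0" "\<sigma> (of_int n) = of_int n" "\<sigma> x = \<sigma> y \<longleftrightarrow> x = y"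
proof -
  show *: "bij \<sigma>" "\<sigma> (x + y) = \<sigma> x + \<sigma> y" "\<sigma> (x * y) = \<sigma> x * \<sigma> y" "\<sigma> 1 = 1" "\<sigma> (of_rat q) = of_rat q"
    for x y q
    using assms by (auto simp: gal_def ring_iso_def Ring.ring_hom_def)
  show "\<sigma> 0 = 0" using *(5)[of 0] by simp
  show "\<sigma> (of_int n) = of_int n" using *(5)[of "of_int n"] by simp
  show "\<sigma> x = \<sigma> y \<longleftrightarrow> x = y" using *(1) by (simp add: bij_is_inj inj_eq)
qed

lemma galI:
  fixes \<sigma> :: "'k::field_char_0 \<Rightarrow> 'k"
  assumes "bij \<sigma>" "\<And>x y. \<sigma> (x + y) = \<sigma> x + \<sigma> y" "\<And>x y. \<sigma> (x * y) = \<sigma> x * \<sigma> y" "\<sigma> 1 = 1"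
    "\<And>q. \<sigma> (of_rat q) = of_rat q"
  shows "\<sigma> \<in> gal"
  using assms by (simp add: gal_def ring_iso_def Ring.ring_hom_def)

lemma id_in_gal: "id \<in> (gal :: ('k::field_char_0 \<Rightarrow> 'k) set)"
  by (rule galI) auto

lemma comp_in_gal:
  fixes \<sigma> \<tau> :: "'k::field_char_0 \<Rightarrow> 'k"
  assumes "\<sigma> \<in> gal" "\<tau> \<in> gal"
  shows "\<sigma> \<circ> \<tau> \<in> gal"
  by (rule galI) (simp_all add: bij_comp galD[OF assms(1)] galD[OF assms(2)])

lemma inv_gal:
  fixes \<sigma> :: "'k::field_char_0 \<Rightarrow> 'k"
  assumes "\<sigma> \<in> gal"
  shows "inv_into UNIV \<sigma> \<in> gal" "\<sigma> (inv_into UNIV \<sigma> x) = x" "inv_into UNIV \<sigma> (\<sigma> x) = x"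
proof -
  note \<sigma> = galD[OF assms]
  have inj: "inj \<sigma>" and surj: "surj \<sigma>" using \<sigma>(1) by (auto simp: bij_def)
  show *: "\<sigma> (inv_into UNIV \<sigma> x) = x" "inv_into UNIV \<sigma> (\<sigma> x) = x" for x
    by (simp_all add: surj_f_inv_f[OF surj] inv_f_f[OF inj])
  show "inv_into UNIV \<sigma> \<in> gal"
  proof (rule galI)
    show "bij (inv_into UNIV \<sigma>)" using \<sigma>(1) by (rule bij_imp_bij_inv)
    show "inv_into UNIV \<sigma> (x + y) = inv_into UNIV \<sigma> x + inv_into UNIV \<sigma> y" for x y
      using *(2)[of "inv_into UNIV \<sigma> x + inv_into UNIV \<sigma> y"] by (simp add: \<sigma>(2) *(1))
    show "inv_into UNIV \<sigma> (x * y) = inv_into UNIV \<sigma> x * inv_into UNIV \<sigma> y" for x y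
      using *(2)[of "inv_into UNIV \<sigma> x * inv_into UNIV \<sigma> y"] by (simp add: \<sigma>(3) *(1))
    show "inv_into UNIV \<sigma> 1 = 1" using *(2)[of 1] by (simp add: \<sigma>(4))
    show "inv_into UNIV \<sigma> (of_rat q) = of_rat q" for q using *(2)[of "of_rat q"] by (simp add: \<sigma>(5))
  qed
qed

lemma gal_image_inv:
  fixes \<sigma> :: "'k::field_char_0 \<Rightarrow> 'k"
  assumes "\<sigma> \<in> gal"
  shows "\<sigma> ` inv_into UNIV \<sigma> ` A = A" "inv_into UNIV \<sigma> ` \<sigma> ` A = A"
  by (simp_all add: image_image inv_gal[OF assms])

lemma gal_poly:
  fixes \<sigma> :: "'k::field_char_0 \<Rightarrow> 'k"
  assumes "\<sigma> \<in> gal"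
  shows "\<sigma> (poly (map_poly of_int p) x) = poly (map_poly of_int p) (\<sigma> x)"
  by (induction p) (simp_all add: map_poly_pCons galD[OF assms])

lemma gal_algebraic_int:
  fixes \<sigma> :: "'k::field_char_0 \<Rightarrow> 'k"
  assumes "\<sigma> \<in> gal" "algebraic_int x"
  shows "algebraic_int (\<sigma> x)"
proof -
  obtain p where p: "poly (map_poly of_int p) x = 0" "monic p"
    using assms(2) by (auto simp: algebraic_int_altdef_ipoly)
  then have "poly (map_poly of_int p) (\<sigma> x) = 0"
    using gal_poly[OF assms(1), of p x] galD(6)[OF assms(1)] by simp
  then show ?thesis using p(2) by (auto simp: algebraic_int_altdef_ipoly)
qed

text \<open>The hypothesis at the inverse of \<open>\<sigma>\<close>, pushed forward by
  \<open>\<sigma>\<close>, is the reverse inclusion.\<close>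

lemma gal_invariant_if_subset:
  fixes A :: "'k::field_char_0 set"
  assumes "\<And>\<sigma>. \<sigma> \<in> gal \<Longrightarrow> \<sigma> ` A \<subseteq> A" and "\<sigma> \<in> gal"
  shows "\<sigma> ` A = A"
  using assms(1)[OF assms(2)] image_mono[OF assms(1)[OF inv_gal(1)[OF assms(2)]], of \<sigma>]
  by (simp add: gal_image_inv[OF assms(2)])

lemma gal_ring_of_integers:
  fixes \<sigma> :: "'k::field_char_0 \<Rightarrow> 'k"
  assumes "\<sigma> \<in> gal"
  shows "\<sigma> ` ring_of_integers = ring_of_integers"
  using assms by (rule gal_invariant_if_subset[rotated]) (auto simp: ring_of_integers_def gal_algebraic_int)

lemma subring_gal_image:
  fixes \<sigma> :: "'k::field_char_0 \<Rightarrow> 'k"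
  assumes "\<sigma> \<in> gal" and S: "subring S ring_of_type_algebra"
  shows "subring (\<sigma> ` S) ring_of_type_algebra"
  unfolding subring_type_iff
proof (intro conjI ballI)
  note \<sigma> = galD[OF assms(1)]
  show "1 \<in> \<sigma> ` S" using imageI[OF subringD(1)[OF S], of \<sigma>] by (simp add: \<sigma>(4))
  show "x + y \<in> \<sigma> ` S" "x * y \<in> \<sigma> ` S" if "x \<in> \<sigma> ` S" "y \<in> \<sigma> ` S" for x y
    using that subringD(4,5)[OF S] by (auto simp flip: \<sigma>(2,3))
  show "- x \<in> \<sigma> ` S" if x: "x \<in> \<sigma> ` S" for x
  proof -
    obtain s where s: "s \<in> S" "x = \<sigma> s" using x by blast
    have "- x = \<sigma> (of_int (-1) * s)" by (simp only: \<sigma>(3,7) s(2)) simp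
    then show ?thesis using subringD(5)[OF S subringD(6)[OF S] s(1)] by blast
  qed
qed

lemma primeideal_gal_image:
  fixes \<sigma> :: "'k::field_char_0 \<Rightarrow> 'k"
  assumes "\<sigma> \<in> gal" and S: "subring S ring_of_type_algebra" and P: "primeideal P (subring_of S)"
  shows "primeideal (\<sigma> ` P) (subring_of (\<sigma> ` S))"
  unfolding primeideal_subring_of_iff[OF subring_gal_image[OF assms(1,2)]]
    ideal_subring_of_iff[OF subring_gal_image[OF assms(1,2)]]
proof (intro conjI ballI impI)
  note \<sigma> = galD[OF assms(1)] and P = primeidealD[OF S P]
  have mem: "\<sigma> x \<in> \<sigma> ` P \<longleftrightarrow> x \<in> P" for x by (auto simp: \<sigma>(8))
  show "\<sigma> ` P \<subseteq> \<sigma> ` S" using P(1) by (rule image_mono)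
  show "0 \<in> \<sigma> ` P" using mem[of 0] P(2) by (simp add: \<sigma>(6))
  show "1 \<notin> \<sigma> ` P" using mem[of 1] P(3) by (simp add: \<sigma>(4))
  show "a + b \<in> \<sigma> ` P" if "a \<in> \<sigma> ` P" "b \<in> \<sigma> ` P" for a b
    using that P(4) by (auto simp flip: \<sigma>(2))
  show "r * a \<in> \<sigma> ` P" if "r \<in> \<sigma> ` S" "a \<in> \<sigma> ` P" for r a
    using that P(5) by (auto simp flip: \<sigma>(3))
  show "a \<in> \<sigma> ` P \<or> b \<in> \<sigma> ` P" if ab: "a \<in> \<sigma> ` S" "b \<in> \<sigma> ` S" "a * b \<in> \<sigma> ` P" for a b
  proof -
    obtain c d where cd: "c \<in> S" "d \<in> S" "a = \<sigma> c" "b = \<sigma> d" using ab(1,2) by blast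
    then show ?thesis using P(6)[OF cd(1,2)] ab(3) mem[of "c * d"] by (auto simp: \<sigma>(3))
  qed
qed

lemma spec_gal_image:
  fixes \<sigma> :: "'k::field_char_0 \<Rightarrow> 'k"
  assumes "\<sigma> \<in> gal" and "P \<in> spec ring_of_integers"
  shows "\<sigma> ` P \<in> spec ring_of_integers"
  using primeideal_gal_image[OF assms(1) subring_ring_of_integers, of P] assms(2)
  by (simp add: spec_def gal_ring_of_integers[OF assms(1)])

lemma lies_over_gal_image:
  fixes \<sigma> :: "'k::field_char_0 \<Rightarrow> 'k"
  assumes "\<sigma> \<in> gal"
  shows "lies_over (\<sigma> ` P) p \<longleftrightarrow> lies_over P p"
proof -
  have "of_int n \<in> \<sigma> ` P \<longleftrightarrow> of_int n \<in> P" for n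
    using galD(8)[OF assms, of "of_int n"] galD(7)[OF assms, of n] by (auto simp: image_iff)
  then show ?thesis by (simp add: lies_over_def)
qed

section \<open>Finiteness of the Galois group, norms, and primes above rational primes\<close>

lemma number_field_basis:
  assumes "galois_number_field TYPE('k::field_char_0)"
  obtains B :: "'k::field_char_0 set" where "finite_dimensional_vector_space rat_scale B"
  using assms by (auto simp: galois_number_field_def)

text \<open>Multiplication by \<open>x\<close> preserves the span of a finite rational basis, so the
  determinant trick over the rationals applies. A basis element serves as the required nonzero
  vector.\<close>

lemma number_field_algebraic:
  fixes x :: "'k::field_char_0"
  assumes "galois_number_field TYPE('k)"
  shows "algebraic x"
proof -
  obtain B :: "'k set" where "finite_dimensional_vector_space rat_scale B"
    using number_field_basis[OF assms] .
  then interpret V: finite_dimensional_vector_space rat_scale B .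
  have "B \<noteq> {}"
  proof
    assume "B = {}"
    then have "(1 :: 'k) \<in> V.span {}" using V.span_Basis by simp
    then show False by simp
  qed
  then obtain b where b: "b \<in> B" by blast
  then have "b \<noteq> 0" using V.dependent_zero V.independent_Basis by metis
  have "\<exists>p. monic p \<and> poly (map_poly of_rat p) x = 0"
  proof (rule root_of_monic_poly_if_finite_stable)
    show "comm_ring_hom (of_rat :: rat \<Rightarrow> 'k)"
      by unfold_locales (auto simp: of_rat_add of_rat_mult)
    show "\<exists>c. x * v = (\<Sum>w\<in>B. of_rat (c w) * w)" for v
    proof -
      have "x * v \<in> range (\<lambda>u. \<Sum>w\<in>B. rat_scale (u w) w)"
        using V.span_finite[OF V.finite_Basis] V.span_Basis by simp
      then show ?thesis by (auto simp: rat_scale_def)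
    qed
  qed (use V.finite_Basis b \<open>b \<noteq> 0\<close> in auto)
  then obtain p where p: "monic p" "poly (map_poly of_rat p) x = 0" by blast
  show ?thesis
  proof (rule algebraicI')
    show "coeff (map_poly of_rat p :: 'k poly) i \<in> \<rat>" for i by (simp add: coeff_map_poly)
    have "coeff (map_poly of_rat p :: 'k poly) (degree p) = 1" using p(1) by (simp add: coeff_map_poly)
    then show "(map_poly of_rat p :: 'k poly) \<noteq> 0" by auto
  qed fact
qed

text \<open>An automorphism is determined by its values on a basis, and each basis element can only
  go to one of the finitely many roots of a fixed integer polynomial.\<close>

lemma finite_gal:
  assumes "galois_number_field TYPE('k::field_char_0)"
  shows "finite (gal :: ('k::field_char_0 \<Rightarrow> 'k) set)"
proof -
  obtain B :: "'k set" where "finite_dimensional_vector_space rat_scale B"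
    using number_field_basis[OF assms] .
  then interpret V: finite_dimensional_vector_space rat_scale B .
  have "\<exists>p. p \<noteq> 0 \<and> poly (map_poly of_int p) b = 0" for b :: 'k
    using algebraicE'[OF number_field_algebraic[OF assms, of b]] by metis
  then obtain q where q: "\<And>b::'k. q b \<noteq> 0" "\<And>b::'k. poly (map_poly of_int (q b)) b = 0" by metis
  define Z where "Z b = {y :: 'k. poly (map_poly of_int (q b)) y = 0}" for b
  have "finite (Z b)" for b
    unfolding Z_def using q(1)[of b] by (intro poly_roots_finite) (simp add: map_poly_eq_0_iff)
  then have "finite (PiE B Z)" using V.finite_Basis by (intro finite_PiE) auto
  moreover have "(\<lambda>\<sigma>. restrict \<sigma> B) ` gal \<subseteq> PiE B Z"
    using gal_poly[of _ "q b" b for b] galD(6) q(2) by (fastforce simp: Z_def)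
  moreover have "inj_on (\<lambda>\<sigma>. restrict \<sigma> B) gal"
  proof (rule inj_onI)
    fix \<sigma> \<tau> :: "'k \<Rightarrow> 'k"
    assume \<sigma>: "\<sigma> \<in> gal" and \<tau>: "\<tau> \<in> gal" and eq: "restrict \<sigma> B = restrict \<tau> B"
    have B: "\<sigma> b = \<tau> b" if "b \<in> B" for b using fun_cong[OF eq, of b] that by simp
    have "\<sigma> x = \<tau> x" for x
    proof -
      have "x \<in> V.span B" using V.span_Basis by simp
      then show ?thesis
      proof (induction rule: V.span_induct_alt)
        case base
        show ?case by (simp add: galD(6)[OF \<sigma>] galD(6)[OF \<tau>])
      next
        case (step c x y)
        then show ?case by (simp add: rat_scale_def galD[OF \<sigma>] galD[OF \<tau>] B)
      qed
    qed
    then show "\<sigma> = \<tau>" by blast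
  qed
  ultimately show ?thesis using finite_subset finite_imageD by metis
qed

text \<open>The norm is an algebraic integer fixed by every automorphism \<open>\<tau>\<close>,
  because composing with \<open>\<tau>\<close> only permutes the factors. As the fixed field is the
  rationals, it is a rational algebraic integer.\<close>

lemma prod_gal_in_Ints:
  fixes x :: "'k::field_char_0"
  assumes K: "galois_number_field TYPE('k)" and x: "algebraic_int x"
  shows "(\<Prod>\<sigma>\<in>gal. \<sigma> x) \<in> \<int>"
proof (rule rational_algebraic_int_is_int)
  show "algebraic_int (\<Prod>\<sigma>\<in>gal. \<sigma> x)"
    using gal_algebraic_int x by (intro algebraic_int_prod)
  have "\<tau> (\<Prod>\<sigma>\<in>gal. \<sigma> x) = (\<Prod>\<sigma>\<in>gal. \<sigma> x)" if \<tau>: "\<tau> \<in> gal" for \<tau> :: "'k \<Rightarrow> 'k"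
  proof -
    have "\<tau> (prod f A) = (\<Prod>a\<in>A. \<tau> (f a))" for f :: "('k \<Rightarrow> 'k) \<Rightarrow> 'k" and A
      by (induction A rule: infinite_finite_induct) (simp_all add: galD[OF \<tau>])
    then have "\<tau> (\<Prod>\<sigma>\<in>gal. \<sigma> x) = (\<Prod>\<sigma>\<in>gal. (\<tau> \<circ> \<sigma>) x)" by simp
    also have "\<dots> = (\<Prod>\<sigma>\<in>gal. \<sigma> x)"
    proof (rule prod.reindex_bij_witness[of _ "\<lambda>\<sigma>. inv_into UNIV \<tau> \<circ> \<sigma>" "\<lambda>\<sigma>. \<tau> \<circ> \<sigma>"])
      show "inv_into UNIV \<tau> \<circ> (\<tau> \<circ> \<sigma>) = \<sigma>" "\<tau> \<circ> (inv_into UNIV \<tau> \<circ> \<sigma>) = \<sigma>" for \<sigma> :: "'k \<Rightarrow> 'k"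
        by (simp_all add: fun_eq_iff inv_gal[OF \<tau>])
    qed (use \<tau> comp_in_gal inv_gal(1)[OF \<tau>] in auto)
    finally show ?thesis .
  qed
  moreover have "{x :: 'k. \<forall>\<sigma>\<in>gal. \<sigma> x = x} = \<rat>"
    using K by (simp add: galois_number_field_def)
  ultimately show "(\<Prod>\<sigma>\<in>gal. \<sigma> x) \<in> \<rat>" by blast
qed

text \<open>The factor at \<open>id\<close> is \<open>x\<close> itself, and the remaining conjugates
  are algebraic integers.\<close>

lemma prod_gal_in_prime:
  fixes x :: "'k::field_char_0"
  assumes K: "galois_number_field TYPE('k)" and P: "P \<in> spec ring_of_integers" and "x \<in> P"
  shows "(\<Prod>\<sigma>\<in>gal. \<sigma> x) \<in> P"
proof -
  note O = subring_ring_of_integers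
  have P': "primeideal P (subring_of ring_of_integers)" using P by (simp add: spec_def)
  have x: "algebraic_int x" using primeidealD(1)[OF O P'] \<open>x \<in> P\<close> by (auto simp: ring_of_integers_def)
  have "(\<Prod>\<sigma>\<in>gal. \<sigma> x) = (\<Prod>\<sigma>\<in>gal - {id}. \<sigma> x) * x"
    using prod.remove[OF finite_gal[OF K] id_in_gal, of "\<lambda>\<sigma>. \<sigma> x"] by (simp add: mult.commute)
  moreover have "(\<Prod>\<sigma>\<in>gal - {id}. \<sigma> x) \<in> ring_of_integers"
    unfolding ring_of_integers_def using gal_algebraic_int x
    by (intro CollectI algebraic_int_prod) auto
  ultimately show ?thesis using primeidealD(5)[OF O P'] \<open>x \<in> P\<close> by simp
qed

text \<open>
  A weak form of the transitivity of the Galois group on the primes above \<open>p\<close>: the norm of an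
  element of \<open>Q\<close> lies in \<open>p\<int>\<close>, hence in \<open>P\<close>, so \<open>Q\<close> is covered by the conjugates of \<open>P\<close>.
\<close>

lemma lies_over_subset_conjugate:
  fixes P Q :: "'k::field_char_0 set"
  assumes K: "galois_number_field TYPE('k)"
    and P: "P \<in> spec ring_of_integers" and Q: "Q \<in> spec ring_of_integers"
    and "lies_over P p" "lies_over Q p"
  obtains \<sigma> where "\<sigma> \<in> gal" "Q \<subseteq> \<sigma> ` P"
proof -
  note O = subring_ring_of_integers
  have P': "primeideal P (subring_of ring_of_integers)" and Q': "primeideal Q (subring_of ring_of_integers)"
    using P Q by (simp_all add: spec_def)
  have "\<exists>\<sigma>\<in>gal. Q \<subseteq> \<sigma> ` P"
  proof (rule prime_avoidance[OF O _ finite_gal[OF K]])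
    show "ideal Q (subring_of ring_of_integers)" using Q' by (rule primeideal.axioms(1))
    show "primeideal (\<sigma> ` P) (subring_of ring_of_integers)" if "\<sigma> \<in> gal" for \<sigma>
      using spec_gal_image[OF that P] by (simp add: spec_def)
    show "Q \<subseteq> (\<Union>\<sigma>\<in>gal. \<sigma> ` P)"
    proof
      fix x assume x: "x \<in> Q"
      then have int: "algebraic_int x" using primeidealD(1)[OF O Q'] by (auto simp: ring_of_integers_def)
      obtain n where n: "(\<Prod>\<sigma>\<in>gal. \<sigma> x) = of_int n"
        using prod_gal_in_Ints[OF K int] by (rule Ints_cases)
      \<comment> \<open>The norm is an integer, and \<open>P\<close> and \<open>Q\<close> contain
        the same integers.\<close>
      have "n \<in> {n. of_int n \<in> Q}" using prod_gal_in_prime[OF K Q x] n by simp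
      moreover have "{n. of_int n \<in> Q} = {n. of_int n \<in> P}" using assms(4,5) by (simp add: lies_over_def)
      ultimately have "n \<in> {n. of_int n \<in> P}" by simp
      then have "(\<Prod>\<sigma>\<in>gal. \<sigma> x) \<in> P" using n by simp
      \<comment> \<open>Primality of \<open>P\<close> singles out a conjugate
        \<open>\<sigma> x\<close> in \<open>P\<close>, so \<open>x\<close> lies in the image of
        \<open>P\<close> under the inverse of \<open>\<sigma>\<close>.\<close>
      then obtain \<sigma> where \<sigma>: "\<sigma> \<in> gal" "\<sigma> x \<in> P"
        using primeideal_prodD[OF O P' finite_gal[OF K], of "\<lambda>\<sigma>. \<sigma> x"] gal_algebraic_int int
        by (auto simp: ring_of_integers_def)
      then have "x \<in> inv_into UNIV \<sigma> ` P" using imageI[OF \<sigma>(2), of "inv_into UNIV \<sigma>"] by (simp add: inv_gal[OF \<sigma>(1)])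
      then show "x \<in> (\<Union>\<sigma>\<in>gal. \<sigma> ` P)" using inv_gal(1)[OF \<sigma>(1)] by blast
    qed
  qed
  then show ?thesis using that by blast
qed

text \<open>The integers in \<open>P\<close> form an ideal generated by some \<open>g\<close>, which
  inherits primality from \<open>P\<close>. It is nonzero because the norm of a nonzero element of
  \<open>P\<close> is a nonzero integer in \<open>P\<close>.\<close>

lemma nonzero_prime_lies_over:
  fixes P :: "'k::field_char_0 set"
  assumes K: "galois_number_field TYPE('k)" and P: "P \<in> spec ring_of_integers" and "P \<noteq> {0}"
  obtains p :: nat where "Factorial_Ring.prime p" "lies_over P p"
proof -
  note O = subring_ring_of_integers
  have P': "primeideal P (subring_of ring_of_integers)" using P by (simp add: spec_def)
  note PD = primeidealD[OF O P']
  define J where "J = {n :: int. of_int n \<in> P}"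
  have "0 \<in> J" "\<And>a b. a \<in> J \<Longrightarrow> b \<in> J \<Longrightarrow> a + b \<in> J" "\<And>a k. a \<in> J \<Longrightarrow> k * a \<in> J"
    using PD(2,4) PD(5)[OF subringD(6)[OF O]] by (simp_all add: J_def)
  then obtain g where g: "J = {n. g dvd n}" using int_ideal_principal by metis
  have g_mem: "of_int n \<in> P \<longleftrightarrow> g dvd n" for n using g by (auto simp: J_def set_eq_iff)
  obtain x where x: "x \<in> P" "x \<noteq> 0" using assms(3) PD(2) by blast
  then have "algebraic_int x" using PD(1) by (auto simp: ring_of_integers_def)
  then obtain n where n: "(\<Prod>\<sigma>\<in>gal. \<sigma> x) = of_int n"
    using prod_gal_in_Ints[OF K] by (metis Ints_cases)
  have "\<sigma> x \<noteq> 0" if "\<sigma> \<in> gal" for \<sigma> using galD(8)[OF that, of x 0] galD(6)[OF that] x(2) by simp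
  then have "(\<Prod>\<sigma>\<in>gal. \<sigma> x) \<noteq> 0" using finite_gal[OF K] by simp
  then have "n \<noteq> 0" using n by auto
  moreover have "g dvd n" using prod_gal_in_prime[OF K P x(1)] g_mem[of n] n by simp
  ultimately have "g \<noteq> 0" by auto
  moreover have "\<not> g dvd 1" using g_mem[of 1] PD(3) by simp
  moreover have "g dvd a \<or> g dvd b" if "g dvd a * b" for a b
    using that PD(6)[OF subringD(6)[OF O] subringD(6)[OF O], of a b] g_mem[of a] g_mem[of b] g_mem[of "a * b"]
    by simp
  ultimately have "prime_elem g" by (intro prime_elemI) auto
  \<comment> \<open>The generator is fixed only up to sign, hence the absolute value.\<close>
  then have "Factorial_Ring.prime \<bar>g\<bar>" by simp
  then have "Factorial_Ring.prime (nat \<bar>g\<bar>)" by simp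
  moreover have "lies_over P (nat \<bar>g\<bar>)" using g by (simp add: lies_over_def J_def)
  ultimately show ?thesis by (rule that)
qed

subsection \<open>Fractional ideals and overrings\<close>

lemma fractional_ideal_iff:
  fixes R :: "'k::field_char_0 set"
  assumes R: "subring R ring_of_type_algebra"
  shows "fractional_ideal R I \<longleftrightarrow>
    0 \<in> I \<and> (\<forall>a\<in>I. \<forall>b\<in>I. a + b \<in> I) \<and> (\<forall>r\<in>R. \<forall>a\<in>I. r * a \<in> I) \<and> I \<noteq> {0} \<and>
    (\<exists>\<alpha>. \<alpha> \<noteq> 0 \<and> (\<lambda>x. \<alpha> * x) ` I \<subseteq> R)"
proof -
  let ?M = "field_module :: ('k, 'k) module"
  have simps: "carrier ?M = UNIV" "x \<oplus>\<^bsub>?M\<^esub> y = x + y" "\<zero>\<^bsub>?M\<^esub> = 0" "x \<odot>\<^bsub>?M\<^esub> y = x * y" for x y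
    by (simp_all add: field_module_def)
  interpret M: group "add_monoid ?M"
  proof (rule groupI)
    show "\<exists>y\<in>carrier (add_monoid ?M). y \<otimes>\<^bsub>add_monoid ?M\<^esub> x = \<one>\<^bsub>add_monoid ?M\<^esub>" for x
      by (rule bexI[of _ "- x"]) (simp_all add: simps)
  qed (simp_all add: simps add.assoc)
  have minus: "inv\<^bsub>add_monoid ?M\<^esub> x = - x" for x
    by (rule M.inv_equality) (simp_all add: simps)
  have "submodule I (subring_of R) ?M \<longleftrightarrow>
    0 \<in> I \<and> (\<forall>a\<in>I. \<forall>b\<in>I. a + b \<in> I) \<and> (\<forall>r\<in>R. \<forall>a\<in>I. r * a \<in> I)" (is "_ \<longleftrightarrow> ?C")
  proof
    assume "submodule I (subring_of R) ?M"
    then interpret I: submodule I "subring_of R" ?M .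
    show ?C
    proof (intro conjI ballI)
      show "0 \<in> I" using I.one_closed by (simp add: simps)
      show "a + b \<in> I" if "a \<in> I" "b \<in> I" for a b using I.m_closed[OF that] by (simp add: simps)
      show "r * a \<in> I" if "r \<in> R" "a \<in> I" for r a
        using I.smult_closed[of r a] that by (simp add: simps)
    qed
  next
    assume C: ?C
    show "submodule I (subring_of R) ?M"
    proof (intro submodule.intro submodule_axioms.intro M.subgroupI)
      show "inv\<^bsub>add_monoid ?M\<^esub> a \<in> I" if "a \<in> I" for a
      proof -
        have "- 1 * a \<in> I" using C that subringD(3)[OF R subringD(1)[OF R]] by blast
        then show ?thesis by (simp add: minus)
      qed
    qed (use C in \<open>auto simp: simps\<close>)
  qed
  then show ?thesis by (simp add: fractional_ideal_def conj_assoc)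
qed

text \<open>Scalars from \<open>R\<close> act on the image through their preimages, which can be
  taken in \<open>R\<close> because \<open>\<sigma>\<close> maps \<open>R\<close> onto itself, and a
  denominator \<open>\<alpha>\<close> of \<open>I\<close> becomes the denominator
  \<open>\<sigma> \<alpha>\<close>.\<close>

lemma fractional_ideal_gal_image:
  fixes R :: "'k::field_char_0 set"
  assumes R: "subring R ring_of_type_algebra" and \<sigma>: "\<sigma> \<in> gal" and "\<sigma> ` R = R"
    and I: "fractional_ideal R I"
  shows "fractional_ideal R (\<sigma> ` I)"
  unfolding fractional_ideal_iff[OF R]
proof (intro conjI ballI)
  note \<sigma>D = galD[OF \<sigma>]
  have I': "0 \<in> I" "\<And>a b. a \<in> I \<Longrightarrow> b \<in> I \<Longrightarrow> a + b \<in> I" "\<And>r a. r \<in> R \<Longrightarrow> a \<in> I \<Longrightarrow> r * a \<in> I"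
    "I \<noteq> {0}" "\<exists>\<alpha>. \<alpha> \<noteq> 0 \<and> (\<lambda>x. \<alpha> * x) ` I \<subseteq> R"
    using I unfolding fractional_ideal_iff[OF R] by simp_all
  show "0 \<in> \<sigma> ` I" using imageI[OF I'(1), of \<sigma>] by (simp add: \<sigma>D(6))
  show "a + b \<in> \<sigma> ` I" if "a \<in> \<sigma> ` I" "b \<in> \<sigma> ` I" for a b
    using that I'(2) by (auto simp flip: \<sigma>D(2))
  show "r * a \<in> \<sigma> ` I" if ra: "r \<in> R" "a \<in> \<sigma> ` I" for r a
  proof -
    obtain s b where "s \<in> R" "r = \<sigma> s" "b \<in> I" "a = \<sigma> b" using \<open>\<sigma> ` R = R\<close> ra by blast
    then show ?thesis using I'(3) by (auto simp flip: \<sigma>D(3))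
  qed
  show "\<sigma> ` I \<noteq> {0}"
  proof -
    obtain a where "a \<in> I" "a \<noteq> 0" using I'(1,4) by blast
    then have "\<sigma> a \<in> \<sigma> ` I" "\<sigma> a \<noteq> 0" using \<sigma>D(8)[of a 0] by (simp_all add: \<sigma>D(6))
    then show ?thesis by blast
  qed
  obtain \<alpha> where \<alpha>: "\<alpha> \<noteq> 0" "(\<lambda>x. \<alpha> * x) ` I \<subseteq> R" using I'(5) by blast
  have "(\<lambda>x. \<sigma> \<alpha> * x) ` \<sigma> ` I = \<sigma> ` (\<lambda>x. \<alpha> * x) ` I" by (simp add: image_image \<sigma>D(3))
  also have "\<dots> \<subseteq> R" using image_mono[OF \<alpha>(2), of \<sigma>] by (simp add: \<open>\<sigma> ` R = R\<close>)
  finally show "\<exists>\<alpha>. \<alpha> \<noteq> 0 \<and> (\<lambda>x. \<alpha> * x) ` \<sigma> ` I \<subseteq> R"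
    using \<alpha>(1) \<sigma>D(8)[of \<alpha> 0] by (intro exI[of _ "\<sigma> \<alpha>"]) (simp add: \<sigma>D(6))
qed

text \<open>A fractional ideal lies in its own class through the scalar 1, and nonzero scalars
  compose and invert, so equality of classes reduces to proportionality.\<close>

lemma ideal_class_eq_iff:
  fixes R :: "'k::field_char_0 set"
  assumes "fractional_ideal R I"
  shows "ideal_class R I = ideal_class R J \<longleftrightarrow> (\<exists>\<alpha>. \<alpha> \<noteq> 0 \<and> I = (\<lambda>x. \<alpha> * x) ` J)"
proof
  assume "ideal_class R I = ideal_class R J"
  moreover have "I \<in> ideal_class R I"
    using assms by (auto simp: ideal_class_def intro!: exI[of _ 1])
  ultimately show "\<exists>\<alpha>. \<alpha> \<noteq> 0 \<and> I = (\<lambda>x. \<alpha> * x) ` J" by (simp add: ideal_class_def)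
next
  assume "\<exists>\<alpha>. \<alpha> \<noteq> 0 \<and> I = (\<lambda>x. \<alpha> * x) ` J"
  then obtain \<alpha> where \<alpha>: "\<alpha> \<noteq> 0" "I = (\<lambda>x. \<alpha> * x) ` J" by blast
  have "(\<exists>\<beta>. \<beta> \<noteq> 0 \<and> L = (\<lambda>x. \<beta> * x) ` I) \<longleftrightarrow> (\<exists>\<beta>. \<beta> \<noteq> 0 \<and> L = (\<lambda>x. \<beta> * x) ` J)" (is "?l \<longleftrightarrow> ?r") for L
  proof
    assume ?l
    then obtain \<beta> where "\<beta> \<noteq> 0" "L = (\<lambda>x. \<beta> * x) ` I" by blast
    then show ?r using \<alpha>
      by (intro exI[of _ "\<beta> * \<alpha>"]) (simp add: image_image mult.assoc)
  next
    assume ?r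
    then obtain \<beta> where "\<beta> \<noteq> 0" "L = (\<lambda>x. \<beta> * x) ` J" by blast
    then show ?l using \<alpha>
      by (intro exI[of _ "\<beta> / \<alpha>"]) (simp add: image_image)
  qed
  then show "ideal_class R I = ideal_class R J" by (simp add: ideal_class_def)
qed

text \<open>Testing the action on \<open>I = R\<close> suffices: the image of \<open>R\<close> is
  then an \<open>R\<close>-module containing 1, so it contains \<open>R\<close>, and the inverse
  automorphism gives equality. Conversely, proportionality by \<open>\<alpha>\<close> is carried to
  proportionality by \<open>\<sigma> \<alpha>\<close>.\<close>

lemma class_action_well_defined_iff:
  fixes R :: "'k::field_char_0 set"
  assumes R: "subring R ring_of_type_algebra"
  shows "class_action_well_defined R \<longleftrightarrow> (\<forall>\<sigma>\<in>gal. \<sigma> ` R = R)"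
proof
  assume wd: "class_action_well_defined R"
  have "fractional_ideal R R"
    unfolding fractional_ideal_iff[OF R]
  proof (intro conjI ballI)
    show "R \<noteq> {0}" using subringD(1)[OF R] by force
    show "\<exists>\<alpha>. \<alpha> \<noteq> 0 \<and> (\<lambda>x. \<alpha> * x) ` R \<subseteq> R" by (rule exI[of _ 1]) simp
  qed (simp_all add: subringD[OF R])
  have sub: "R \<subseteq> \<sigma> ` R" if \<sigma>: "\<sigma> \<in> gal" for \<sigma>
  proof
    fix r assume "r \<in> R"
    have "fractional_ideal R (\<sigma> ` R)"
      using wd \<sigma> \<open>fractional_ideal R R\<close> by (simp add: class_action_well_defined_def)
    moreover have "1 \<in> \<sigma> ` R" using imageI[OF subringD(1)[OF R], of \<sigma>] by (simp add: galD(4)[OF \<sigma>])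
    ultimately have "r * 1 \<in> \<sigma> ` R"
      using \<open>r \<in> R\<close> unfolding fractional_ideal_iff[OF R] by blast
    then show "r \<in> \<sigma> ` R" by simp
  qed
  have "\<sigma> ` R \<subseteq> R" if \<sigma>: "\<sigma> \<in> gal" for \<sigma>
    using image_mono[OF sub[OF inv_gal(1)[OF \<sigma>]], of \<sigma>] by (simp add: gal_image_inv[OF \<sigma>])
  then show "\<forall>\<sigma>\<in>gal. \<sigma> ` R = R" using sub by blast
next
  assume inv: "\<forall>\<sigma>\<in>gal. \<sigma> ` R = R"
  have frac: "fractional_ideal R (\<sigma> ` I)" if "\<sigma> \<in> gal" "fractional_ideal R I" for \<sigma> I
    using fractional_ideal_gal_image[OF R that(1) _ that(2)] inv that(1) by simp
  have "ideal_class R (\<sigma> ` I) = ideal_class R (\<sigma> ` J)"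
    if \<sigma>: "\<sigma> \<in> gal" and I: "fractional_ideal R I" and eq: "ideal_class R I = ideal_class R J" for \<sigma> I J
  proof -
    obtain \<alpha> where \<alpha>: "\<alpha> \<noteq> 0" "I = (\<lambda>x. \<alpha> * x) ` J"
      using eq unfolding ideal_class_eq_iff[OF I] by blast
    have "\<sigma> \<alpha> \<noteq> 0" using \<alpha>(1) galD(8)[OF \<sigma>, of \<alpha> 0] by (simp add: galD(6)[OF \<sigma>])
    moreover have "\<sigma> ` I = (\<lambda>x. \<sigma> \<alpha> * x) ` \<sigma> ` J" by (simp add: \<alpha>(2) image_image galD(3)[OF \<sigma>])
    ultimately show ?thesis unfolding ideal_class_eq_iff[OF frac[OF \<sigma> I]] by blast
  qed
  then show "class_action_well_defined R"
    using frac unfolding class_action_well_defined_def by blast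
qed

section \<open>Invariance of \<open>R\<close> read off from primes, and assembly of the
  equivalences\<close>

lemma gal_invariant_if_ext_ideal_invariant:
  fixes R :: "'k::field_char_0 set"
  assumes K: "galois_number_field TYPE('k)" and "overring R"
    and ext: "\<forall>P\<in>spec ring_of_integers. \<forall>\<sigma>\<in>gal. ext_ideal P R = R \<longleftrightarrow> ext_ideal (\<sigma> ` P) R = R"
    and "\<sigma> \<in> gal"
  shows "\<sigma> ` R = R"
proof (rule gal_invariant_if_subset[OF _ \<open>\<sigma> \<in> gal\<close>], rule subsetI)
  fix \<tau> :: "'k \<Rightarrow> 'k" and y
  assume \<tau>: "\<tau> \<in> gal" and "y \<in> \<tau> ` R"
  note O = subring_ring_of_integers
  have R: "subring R ring_of_type_algebra" and OR: "ring_of_integers \<subseteq> R"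
    using \<open>overring R\<close> by (auto simp: overring_def)
  obtain x where x: "x \<in> R" "y = \<tau> x" using \<open>y \<in> \<tau> ` R\<close> by blast
  show "y \<in> R"
  proof (rule ccontr)
    assume "y \<notin> R"
    \<comment> \<open>The denominators of \<open>y\<close> relative to \<open>R\<close>. This ideal
      is proper since \<open>y\<close> is outside \<open>R\<close>, and it contains
      \<open>\<tau> d\<close> for every algebraic integer \<open>d\<close> with \<open>d * x\<close>
      integral.\<close>
    define I where "I = {r \<in> R. r * y \<in> R}"
    have "ideal I (subring_of R)"
      unfolding ideal_subring_of_iff[OF R]
      by (auto simp: I_def distrib_right mult.assoc intro: subringD[OF R])
    moreover have "1 \<notin> I" using \<open>y \<notin> R\<close> by (simp add: I_def)
    ultimately obtain M where M: "primeideal M (subring_of R)" "I \<subseteq> M"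
      by (rule ideal_subset_primeideal[OF R])
    define Q where "Q = M \<inter> ring_of_integers"
    have Q: "Q \<in> spec ring_of_integers"
      unfolding Q_def spec_def using primeideal_contract[OF O R OR M(1)] by simp
    define P where "P = inv_into UNIV \<tau> ` Q"
    have P: "P \<in> spec ring_of_integers" "\<tau> ` P = Q"
      using spec_gal_image[OF inv_gal(1)[OF \<tau>] Q] by (simp_all add: P_def gal_image_inv[OF \<tau>])
    have "P \<subseteq> R"
      using primeidealD(1)[OF O] P(1) OR by (auto simp: spec_def)
    have "Q \<subseteq> R" "Q \<subseteq> M" using OR by (auto simp: Q_def)
    have "ext_ideal Q R \<noteq> R"
      using ext_ideal_eq_iff[OF R \<open>Q \<subseteq> R\<close>] M(1) \<open>Q \<subseteq> M\<close> by blast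
    \<comment> \<open>\<open>Q\<close> lies in \<open>M\<close>, so it does not extend to the whole
      of \<open>R\<close>; condition (3) hands this on to its preimage \<open>P\<close>, which is
      thus contained in some prime \<open>N\<close> of \<open>R\<close>.\<close>
    then have "ext_ideal P R \<noteq> R" using ext P \<tau> by metis
    then obtain N where N: "primeideal N (subring_of R)" "P \<subseteq> N"
      using ext_ideal_eq_iff[OF R \<open>P \<subseteq> R\<close>] by blast
    \<comment> \<open>All integral denominators \<open>d\<close> of \<open>x\<close> lie in
      \<open>N\<close>: \<open>\<tau> d\<close> is an algebraic integer in \<open>I\<close>, hence
      is in \<open>Q\<close>.\<close>
    have D: "d \<in> N" if "algebraic_int d" "algebraic_int (d * x)" for d
    proof -
      have "\<tau> d \<in> ring_of_integers" "\<tau> d * y \<in> ring_of_integers"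
        using gal_algebraic_int[OF \<tau>] that
        by (simp_all add: ring_of_integers_def x(2) flip: galD(3)[OF \<tau>])
      then have "\<tau> d \<in> Q" using OR M(2) by (auto simp: Q_def I_def)
      then have "inv_into UNIV \<tau> (\<tau> d) \<in> P" unfolding P_def by (rule imageI)
      then show ?thesis using N(2) by (auto simp: inv_gal[OF \<tau>])
    qed
    obtain d e where de: "algebraic_int d" "algebraic_int (d * x)" "algebraic_int e" "algebraic_int (e * x)"
      "d + e * x = 1"
      using algebraic_denominators_comaximal[OF number_field_algebraic[OF K]] .
    \<comment> \<open>Here \<open>x \<in> R\<close> enters: it makes \<open>x * e\<close> an element
      of \<open>N\<close>, so the comaximality relation puts 1 in \<open>N\<close>.\<close>
    have "d + x * e \<in> N"
      using primeidealD(4,5)[OF R N(1)] D de x(1) by simp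
    then show False using de(5) primeidealD(3)[OF R N(1)] by (simp add: mult.commute)
  qed
qed

theorem theorem5p8:
  fixes R :: "'k::field_char_0 set"
  assumes "galois_number_field TYPE('k)"
    and "overring R"
  shows "(class_action_well_defined R \<longleftrightarrow> (\<forall>\<sigma>\<in>gal. \<sigma> ` R = R)) \<and>
    (class_action_well_defined R \<longleftrightarrow>
      (\<forall>P\<in>spec ring_of_integers. \<forall>\<sigma>\<in>gal.
         ext_ideal P R = R \<longleftrightarrow> ext_ideal (\<sigma> ` P) R = R)) \<and>
    (class_action_well_defined R \<longleftrightarrow>
      (\<forall>P\<in>spec ring_of_integers. \<forall>Q\<in>spec ring_of_integers. \<forall>p::nat.
         Factorial_Ring.prime p \<and> lies_over P p \<and> lies_over Q p \<longrightarrow>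
         (ext_ideal P R = R \<longleftrightarrow> ext_ideal Q R = R)))"
    (is "(?one \<longleftrightarrow> ?two) \<and> (?one \<longleftrightarrow> ?three) \<and> (?one \<longleftrightarrow> ?four)")
proof -
  have R: "subring R ring_of_type_algebra" and OR: "ring_of_integers \<subseteq> R"
    using assms(2) by (auto simp: overring_def)
  have spec_R: "P \<subseteq> R" if "P \<in> spec ring_of_integers" for P
    using primeidealD(1)[OF subring_ring_of_integers] that OR by (auto simp: spec_def)
  \<comment> \<open>A prime of \<open>R\<close> containing \<open>Q\<close> also contains
    \<open>P\<close>. Monotonicity is what makes the mere inclusion of a prime in a conjugate of
    another usable below.\<close>
  have mono: "ext_ideal Q R = R" if "P \<subseteq> Q" "Q \<in> spec ring_of_integers" "ext_ideal P R = R" for P Q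
    using that ext_ideal_eq_iff[OF R spec_R[OF that(2)]]
      ext_ideal_eq_iff[OF R order_trans[OF that(1) spec_R[OF that(2)]]] by (meson order_trans)
  have one_two: "?one \<longleftrightarrow> ?two" by (rule class_action_well_defined_iff[OF R])
  have two_three: "?three" if ?two
  proof (intro ballI)
    \<comment> \<open>One direction is enough: the other is this one for the image of
      \<open>P\<close> and the inverse automorphism. A prime of \<open>R\<close> containing
      \<open>P\<close> would be carried by \<open>\<sigma>\<close>, which preserves
      \<open>R\<close>, to a prime containing the image of \<open>P\<close>.\<close>
    have image: "ext_ideal P R = R"
      if P: "P \<in> spec ring_of_integers" and \<sigma>: "\<sigma> \<in> gal" and ext: "ext_ideal (\<sigma> ` P) R = R" for P \<sigma>
    proof -
      have "\<not> P \<subseteq> M" if M: "primeideal M (subring_of R)" for M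
      proof
        assume "P \<subseteq> M"
        then have "\<sigma> ` P \<subseteq> \<sigma> ` M" by (rule image_mono)
        moreover have "primeideal (\<sigma> ` M) (subring_of R)"
          using primeideal_gal_image[OF \<sigma> R M] \<open>?two\<close> \<sigma> by simp
        ultimately show False
          using ext ext_ideal_eq_iff[OF R spec_R[OF spec_gal_image[OF \<sigma> P]]] by blast
      qed
      then show ?thesis using ext_ideal_eq_iff[OF R spec_R[OF P]] by blast
    qed
    fix P :: "'k set" and \<sigma> :: "'k \<Rightarrow> 'k" assume P: "P \<in> spec ring_of_integers" and \<sigma>: "\<sigma> \<in> gal"
    show "ext_ideal P R = R \<longleftrightarrow> ext_ideal (\<sigma> ` P) R = R"
      using image[OF P \<sigma>] image[OF spec_gal_image[OF \<sigma> P] inv_gal(1)[OF \<sigma>]]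
      by (auto simp: gal_image_inv[OF \<sigma>])
  qed
  have three_two: "?two" if ?three
    using gal_invariant_if_ext_ideal_invariant[OF assms that] by blast
  have three_four: "?four" if ?three
  proof -
    \<comment> \<open>Only one implication is proved, since \<open>P\<close> and \<open>Q\<close>
      may be exchanged.\<close>
    have "ext_ideal P R = R"
      if P: "P \<in> spec ring_of_integers" and Q: "Q \<in> spec ring_of_integers"
        and p: "lies_over P p" "lies_over Q p" and ext: "ext_ideal Q R = R" for P Q p
    proof -
      obtain \<sigma> where \<sigma>: "\<sigma> \<in> gal" "Q \<subseteq> \<sigma> ` P"
        using lies_over_subset_conjugate[OF assms(1) P Q p] .
      have "ext_ideal (\<sigma> ` P) R = R" using mono[OF \<sigma>(2) spec_gal_image[OF \<sigma>(1) P] ext] .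
      then show ?thesis using \<open>?three\<close> P \<sigma>(1) by blast
    qed
    then show ?thesis by metis
  qed
  have four_three: "?three" if ?four
  proof (intro ballI)
    fix P :: "'k set" and \<sigma> :: "'k \<Rightarrow> 'k" assume P: "P \<in> spec ring_of_integers" and \<sigma>: "\<sigma> \<in> gal"
    show "ext_ideal P R = R \<longleftrightarrow> ext_ideal (\<sigma> ` P) R = R"
    \<comment> \<open>The zero ideal lies over no rational prime, so condition (4) does not reach
      it, but \<open>\<sigma>\<close> fixes it. Any other \<open>P\<close> lies over the same prime
      as its image, and condition (4) compares the two.\<close>
    proof (cases "P = {0}")
      case True
      then have "\<sigma> ` P = P" by (simp add: galD(6)[OF \<sigma>])
      then show ?thesis by simp
    next
      case False
      then obtain p :: nat where "Factorial_Ring.prime p" "lies_over P p"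
        using nonzero_prime_lies_over[OF assms(1) P] by blast
      then show ?thesis
        using \<open>?four\<close> P spec_gal_image[OF \<sigma> P] lies_over_gal_image[OF \<sigma>, of P p] by metis
    qed
  qed
  show ?thesis using one_two two_three three_two three_four four_three by argo
qed

end
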